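(* Let $(K(I\mathbb P(1,3))_{\mathbb C},\star,1=\chi_0^0,\widetilde\psi)$ be the virtual K-theory ring with its virtual $\lambda$-ring structure. The set $\mathcal P_1$ of its $\lambda$-line elements spans the $\mathbb C$-vector space $K(I\mathbb P(1,3))_{\mathbb C}$. The restriction of the inertial dual $\mathcal P_1\to\mathcal P_1$ agrees with the operation of taking the inverse. The set $\mathcal P_1$ consists of $27$ orbits of the action of the translation group $J_{\mathbb C}$, where each orbit has a unique representative in the set $$\{\Sigma_i\}_{i=1}^3\ \sqcup\coprod_{i=1,2,3;\ j=1,2}\{\mathcal D_{i,j}\}\ \sqcup\coprod_{i=1,\dots,6;\ k=0,1,2}\{\mathcal T_{i,k}\},$$ where, with $\zeta_3=\exp(2\pi i/3)$, $j\in\{1,2\}$, $k\in\{0,1,2\}$: $\Sigma_1=\chi_0^0$, $\Sigma_2=\chi_0^1$, $\Sigma_3=\chi_0^2$, $$\mathcal D_{1,j}=\tfrac13\big(\chi_0^0+\chi_0^1+\chi_0^2-\zeta_3^j\chi_1^0+\chi_1^1-\zeta_3^{2j}\chi_2^0+\chi_2^1\big),$$ $$\mathcal D_{2,j}=\tfrac13\big(\chi_0^0+\chi_0^1+\chi_0^2-\chi_1^0+\zeta_3^j\chi_1^1-\chi_2^0+\zeta_3^{2j}\chi_2^1\big),$$ $$\mathcal D_{3,j}=\tfrac13\big(\chi_0^0+\chi_0^1+\chi_0^2-\zeta_3^{2j}\chi_1^0+\zeta_3^j\chi_1^1-\zeta_3^j\chi_2^0+\zeta_3^{2j}\chi_2^1\big),$$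 $$\mathcal T_{1,k}=\tfrac13\big(\chi_0^0+2\chi_0^2+\zeta_3^k\chi_1^0+\zeta_3^{2k}\chi_2^0\big),\qquad \mathcal T_{2,k}=\tfrac13\big(2\chi_0^0+\chi_0^2-\zeta_3^k\chi_1^0-\zeta_3^{2k}\chi_2^0\big),$$ $$\mathcal T_{3,k}=\tfrac13\big(2\chi_0^0+\chi_0^1+\zeta_3^k\chi_1^1+\zeta_3^{2k}\chi_2^1\big),\qquad \mathcal T_{4,k}=\tfrac13\big(\chi_0^0+2\chi_0^1-\zeta_3^k\chi_1^1-\zeta_3^{2k}\chi_2^1\big),$$ $$\mathcal T_{5,k}=\tfrac13\big(\chi_0^1+2\chi_0^2+\zeta_3^k\chi_1^0+\zeta_3^k\chi_1^1+\zeta_3^{2k}\chi_2^0+\zeta_3^{2k}\chi_2^1\big),$$ $$\mathcal T_{6,k}=\tfrac13\big(2\chi_0^1+\chi_0^2-\zeta_3^k\chi_1^0-\zeta_3^k\chi_1^1-\zeta_3^{2k}\chi_2^0-\zeta_3^{2k}\chi_2^1\big).$$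
   Context: $X=\mathbb C^2\smallsetminus\{0\}$ with $\mathbb C^\times$ acting by $t\cdot(a,b)=(ta,t^3b)$; $\mathbb P(1,3)=[X/\mathbb C^\times]$. For $m\in\{0,1,2\}$, $X^m$ is the fixed locus of $e^{2\pi im/3}$: $X^0=X$, $X^1=X^2=\{(0,b):b\ne0\}$. $I\mathbb P(1,3)=[\coprod_mX^m/\mathbb C^\times]$. $\chi_m\in K_{\mathbb C^\times}(X^m)$ is the class of the line bundle of the defining character. With classical products, $K_{\mathbb C^\times}(X^0)=\mathbb Z[\chi_0]/\langle(\chi_0-1)(\chi_0^3-1)\rangle$, $K_{\mathbb C^\times}(X^m)=\mathbb Z[\chi_m]/\langle\chi_m^3-1\rangle$ for $m=1,2$; $K(I\mathbb P(1,3))=\bigoplus_mK_{\mathbb C^\times}(X^m)$. $\chi_m^a$, $a\in\mathbb Z$, denotes the classical power (the subscript is the sector). Subscript $\mathbb C$ means $\otimes\mathbb C$. The virtual product $\star$ is the inertial product for the pair with $\mathscr S$ the normal bundle of $\coprod X^m\to X$ ($\mathscr S|_{X^0}=0$, $\mathscr S|_{X^m}=\chi_m$ for $m=1,2$). Explicitly: $\chi_0^a\star\chi_m^b=\chi_m^{a+b}$; $\chi_1^a\star\chi_2^b=\chi_0^{a+b}(1-\chi_0^{-1})^2$; $\chi_1^a\star\chi_1^b=\chi_2^{a+b}(1-\chi_2^{-1})$; $\chi_2^a\star\chi_2^b=\chi_1^{a+b}(1-\chi_1^{-1})$. The unit is $\chi_0^0$. Inertial Adams operations ($\mathbb C$-linear):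 $\widetilde\psi^\ell(\chi_0^a)=\chi_0^{\ell a}$, $\widetilde\psi^\ell(\chi_m^a)=\chi_m^{\ell a}\sum_{i=0}^{\ell-1}\chi_m^{-i}$ for $m=1,2$. $\widetilde\lambda_t=\exp\big(\sum_{r\ge1}(-1)^{r-1}\widetilde\psi^rt^r/r\big)$ with $\exp$ for $\star$. A $\lambda$-line element is a $\star$-invertible $L$ with $\widetilde\lambda_t(L)=1+tL$. The inertial dual is the ($\mathbb C$-linear) map $\mathscr V\mapsto\mathscr V^\dagger=\mathscr V^*\cdot\rho(\mathscr S^* )$, $\rho(\mathscr S^* )=(-1)^{\mathrm{rk}\mathscr S}\det\mathscr S$ (classical operations); so $(\chi_0^a)^\dagger=\chi_0^{-a}$ and $(\chi_m^a)^\dagger=-\chi_m^{1-a}$ for $m=1,2$. The translation group $J_{\mathbb C}$ is the $\mathbb C$-span of $\Delta_0=\chi_0^3-\chi_0^0$ and $\Delta_m=\chi_m^0+\chi_m^1+\chi_m^2$, $m=1,2$; it acts on $\mathcal P_1$ by addition. *)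

theory Defs
  imports
    Complex_Main
    "HOL-Library.Poly_Mapping"
    "HOL-Computational_Algebra.Formal_Power_Series"
begin

subsection \<open>Laurent polynomials: the complexified representation ring of the group of units\<close>

text \<open>
  Finitely supported functions on the integers, with the convolution product of
  \<^theory>\<open>HOL-Library.Poly_Mapping\<close>, form the ring of Laurent polynomials in the defining
  character.
\<close>

type_synonym laurent = "int \<Rightarrow>\<^sub>0 complex"

definition X :: "int \<Rightarrow> laurent" where
  "X a = Poly_Mapping.single a 1"

definition const :: "complex \<Rightarrow> laurent" where
  "const c = Poly_Mapping.single 0 c"

text \<open>The complex-linear ring endomorphism taking the character to its \<open>n\<close>-th power: the classical
  Adams operation for \<open>n \<ge> 1\<close>, the classical dual for \<open>n = - 1\<close>.\<close>

definition subst_power :: "int \<Rightarrow> laurent \<Rightarrow> laurent" where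
  "subst_power n f =
     (\<Sum>a\<in>Poly_Mapping.keys f. Poly_Mapping.single (n * a) (Poly_Mapping.lookup f a))"

lemma X_add: "X (a + b) = X a * X b"
  by (simp add: X_def mult_single)

lemma X_0 [simp]: "X 0 = 1"
  by (simp add: X_def)

lemma const_mult: "const (c * d) = const c * const d"
  by (simp add: const_def mult_single)

lemma const_add: "const (c + d) = const c + const d"
  by (simp add: const_def single_add)

lemma const_1 [simp]: "const 1 = 1"
  by (simp add: const_def)

lemma subst_power_superset:
  assumes "finite A" "Poly_Mapping.keys f \<subseteq> A"
  shows "subst_power n f =
    (\<Sum>a\<in>A. Poly_Mapping.single (n * a) (Poly_Mapping.lookup f a))"
  unfolding subst_power_def
  by (rule sum.mono_neutral_left) (use assms in \<open>auto simp: in_keys_iff\<close>)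

lemma subst_power_add: "subst_power n (f + g) = subst_power n f + subst_power n g"
proof -
  let ?A = "Poly_Mapping.keys f \<union> Poly_Mapping.keys g"
  have "subst_power n (f + g) =
      (\<Sum>a\<in>?A. Poly_Mapping.single (n * a) (Poly_Mapping.lookup (f + g) a))"
    by (rule subst_power_superset) (use Poly_Mapping.keys_add[of f g] in auto)
  also have "\<dots> = (\<Sum>a\<in>?A. Poly_Mapping.single (n * a) (Poly_Mapping.lookup f a))
      + (\<Sum>a\<in>?A. Poly_Mapping.single (n * a) (Poly_Mapping.lookup g a))"
    by (simp add: lookup_add single_add sum.distrib)
  also have "\<dots> = subst_power n f + subst_power n g"
    by (simp add: subst_power_superset[of ?A f] subst_power_superset[of ?A g])
  finally show ?thesis .
qed

lemma subst_power_single [simp]: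
  "subst_power n (Poly_Mapping.single a c) = Poly_Mapping.single (n * a) c"
  by (cases "c = 0") (simp_all add: subst_power_def)

lemma subst_power_X [simp]: "subst_power n (X a) = X (n * a)"
  by (simp add: X_def)

lemma subst_power_0 [simp]: "subst_power n 0 = 0"
  by (simp add: subst_power_def)

lemma subst_power_1 [simp]: "subst_power n 1 = 1"
  using subst_power_X[of n 0] by simp

lemma subst_power_uminus: "subst_power n (- f) = - subst_power n f"
  using subst_power_add[of n f "- f"] by (simp add: eq_neg_iff_add_eq_0 add.commute)

lemma subst_power_diff: "subst_power n (f - g) = subst_power n f - subst_power n g"
  using subst_power_add[of n f "- g"] by (simp add: subst_power_uminus)

lemma laurent_induct [case_names single add]:
  fixes f :: laurent
  assumes single: "\<And>a c. P (Poly_Mapping.single a c)"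
    and add: "\<And>f g. P f \<Longrightarrow> P g \<Longrightarrow> P (f + g)"
  shows "P f"
proof -
  have "P (\<Sum>a\<in>A. Poly_Mapping.single a (Poly_Mapping.lookup f a))" if "finite A" for A
    using that
  proof (induction A)
    case empty
    show ?case using single[of 0 0] by simp
  next
    case (insert x A)
    then show ?case by (simp add: single add)
  qed
  moreover have "(\<Sum>a\<in>Poly_Mapping.keys f. Poly_Mapping.single a (Poly_Mapping.lookup f a)) = f"
    by (rule poly_mapping_eqI) (auto simp: lookup_sum lookup_single when_def sum.delta in_keys_iff)
  ultimately show ?thesis
    by (metis finite_keys)
qed

lemma subst_power_mult: "subst_power n (f * g) = subst_power n f * subst_power n g"
proof (induction f rule: laurent_induct)
  case (single a c)
  show ?case
    by (induction g rule: laurent_induct)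
      (simp_all add: mult_single distrib_left subst_power_add)
next
  case (add f1 f2)
  then show ?case by (simp add: subst_power_add distrib_right)
qed

lemma subst_power_const [simp]: "subst_power n (const c) = const c"
  by (simp add: const_def)


subsection \<open>The K-group of the inertia stack\<close>

text \<open>\<open>rel_untw\<close> is the relation in the untwisted sector \<open>m = 0\<close>, \<open>rel_tw\<close> the one in the sectors
  \<open>m = 1, 2\<close>.  Negative powers of the character may be adjoined before dividing out, since the
  character already becomes a unit in the quotients of the polynomial ring.\<close>

definition rel_untw :: laurent where
  "rel_untw = (X 1 - 1) * (X 3 - 1)"

definition rel_tw :: laurent where
  "rel_tw = X 3 - 1"

fun sector_eq :: "laurent \<times> laurent \<times> laurent \<Rightarrow> laurent \<times> laurent \<times> laurent \<Rightarrow> bool" where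
  "sector_eq (f0, f1, f2) (g0, g1, g2) \<longleftrightarrow>
     rel_untw dvd f0 - g0 \<and> rel_tw dvd f1 - g1 \<and> rel_tw dvd f2 - g2"

lemma dvd_diff_sym: "(r :: laurent) dvd f - g \<Longrightarrow> r dvd g - f"
  by (metis dvd_minus_iff minus_diff_eq)

lemma dvd_diff_trans: "(r :: laurent) dvd f - g \<Longrightarrow> r dvd g - h \<Longrightarrow> r dvd f - h"
  using dvd_add[of r "f - g" "g - h"] by simp

lemma equivp_sector_eq: "equivp sector_eq"
proof (rule equivpI)
  show "reflp sector_eq" by (rule reflpI) auto
  show "symp sector_eq" by (rule sympI) (auto intro: dvd_diff_sym)
  show "transp sector_eq" by (rule transpI) (auto intro: dvd_diff_trans)
qed

text \<open>\<open>KI\<close> is the direct sum of the complexified K-groups of the three sectors.  Its type-class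
  multiplication, instantiated below, is the virtual product, not the classical (sectorwise) one.\<close>

quotient_type KI = "laurent \<times> laurent \<times> laurent" / sector_eq
  by (rule equivp_sector_eq)

lift_definition chi0 :: "int \<Rightarrow> KI" is "\<lambda>a. (X a, 0, 0)" .
lift_definition chi1 :: "int \<Rightarrow> KI" is "\<lambda>a. (0, X a, 0)" .
lift_definition chi2 :: "int \<Rightarrow> KI" is "\<lambda>a. (0, 0, X a)" .

lift_definition scaleKI :: "complex \<Rightarrow> KI \<Rightarrow> KI" (infixr \<open>*\<^sub>K\<close> 75) is
  "\<lambda>c (f0, f1, f2). (const c * f0, const c * f1, const c * f2)"
  by (auto simp flip: right_diff_distrib)


subsection \<open>The virtual product\<close>

text \<open>The classical Euler class of the dual of the character.\<close>

definition eul :: laurent where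
  "eul = 1 - X (- 1)"

lemma dvd_diff_add:
  "(r :: laurent) dvd f - f' \<Longrightarrow> r dvd g - g' \<Longrightarrow> r dvd (f + g) - (f' + g')"
  using dvd_add[of r "f - f'" "g - g'"] by (simp add: algebra_simps)

lemma dvd_diff_diff:
  "(r :: laurent) dvd f - f' \<Longrightarrow> r dvd g - g' \<Longrightarrow> r dvd (f - g) - (f' - g')"
  using dvd_diff[of r "f - f'" "g - g'"] by (simp add: algebra_simps)

lemma dvd_diff_mult:
  assumes "(r :: laurent) dvd f - f'" "r dvd g - g'"
  shows "r dvd f * g - f' * g'"
proof -
  have "f * g - f' * g' = (f - f') * g + f' * (g - g')"
    by (simp add: algebra_simps)
  then show ?thesis using assms by simp
qed

lemma rel_tw_dvd_rel_untw: "rel_tw dvd rel_untw"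
  by (simp add: rel_untw_def rel_tw_def)

lemma rel_tw_dvdI: "rel_untw dvd f \<Longrightarrow> rel_tw dvd f"
  using rel_tw_dvd_rel_untw dvd_trans by blast

lemma rel_untw_dvd_eul:
  assumes "rel_tw dvd f - g"
  shows "rel_untw dvd eul^2 * f - eul^2 * g"
proof -
  have "X 1 - 1 = X 1 * eul"
    by (simp add: eul_def right_diff_distrib flip: X_add)
  then have "eul = X (- 1) * (X 1 - 1)"
    by (simp add: mult.assoc[symmetric] flip: X_add)
  then have "X 1 - 1 dvd eul" by (metis dvd_triv_right)
  then have "X 1 - 1 dvd eul^2" by (simp add: power2_eq_square)
  then have "rel_untw dvd eul^2 * (f - g)"
    unfolding rel_untw_def using assms by (intro mult_dvd_mono) (simp_all add: rel_tw_def)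
  then show ?thesis by (simp add: right_diff_distrib)
qed

instantiation KI :: comm_ring_1
begin

lift_definition zero_KI :: KI is "(0, 0, 0)" .
lift_definition one_KI :: KI is "(1, 0, 0)" .

lift_definition plus_KI :: "KI \<Rightarrow> KI \<Rightarrow> KI" is
  "\<lambda>(f0, f1, f2) (g0, g1, g2). (f0 + g0, f1 + g1, f2 + g2)"
  by (auto intro: dvd_diff_add)

lift_definition uminus_KI :: "KI \<Rightarrow> KI" is
  "\<lambda>(f0, f1, f2). (- f0, - f1, - f2)"
  by (auto intro: dvd_diff_sym)

lift_definition minus_KI :: "KI \<Rightarrow> KI \<Rightarrow> KI" is
  "\<lambda>(f0, f1, f2) (g0, g1, g2). (f0 - g0, f1 - g1, f2 - g2)"
  by (auto intro: dvd_diff_diff)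

lift_definition times_KI :: "KI \<Rightarrow> KI \<Rightarrow> KI" is
  "\<lambda>(f0, f1, f2) (g0, g1, g2).
     (f0 * g0 + eul^2 * (f1 * g2 + f2 * g1),
      f0 * g1 + f1 * g0 + eul * (f2 * g2),
      f0 * g2 + f2 * g0 + eul * (f1 * g1))"
  by (auto intro!: dvd_diff_add rel_untw_dvd_eul dvd_diff_mult intro: rel_tw_dvdI)

instance
proof
  fix a b c :: KI
  show "a + b + c = a + (b + c)" by transfer (auto simp: add.assoc)
  show "a + b = b + a" by transfer (auto simp: add.commute)
  show "0 + a = a" by transfer auto
  show "- a + a = 0" by transfer auto
  show "a - b = a + - b" by transfer auto
  show "a * b * c = a * (b * c)"
    by transfer (auto simp: algebra_simps power2_eq_square)
  show "a * b = b * a" by transfer (auto simp: algebra_simps)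
  show "1 * a = a" by transfer auto
  show "(a + b) * c = a * c + b * c" by transfer (auto simp: algebra_simps)
  show "(0 :: KI) \<noteq> 1"
  proof transfer
    have "\<not> rel_untw dvd - 1"
    proof
      assume "rel_untw dvd - 1"
      then obtain h where "- 1 = rel_untw * h" by (elim dvdE)
      then have "subst_power 0 (- 1) = subst_power 0 (rel_untw * h)" by simp
      then show False
        by (simp add: subst_power_mult rel_untw_def subst_power_diff subst_power_uminus)
    qed
    then show "\<not> sector_eq (0, 0, 0) (1, 0, 0)" by simp
  qed
qed

end

lemma one_KI_eq: "1 = chi0 0"
  by transfer simp

lemma virtual_product:
  "chi0 a * chi0 b = chi0 (a + b)"
  "chi0 a * chi1 b = chi1 (a + b)"
  "chi0 a * chi2 b = chi2 (a + b)"
  "chi1 a * chi2 b = chi0 (a + b) - 2 * chi0 (a + b - 1) + chi0 (a + b - 2)"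
  "chi1 a * chi1 b = chi2 (a + b) - chi2 (a + b - 1)"
  "chi2 a * chi2 b = chi1 (a + b) - chi1 (a + b - 1)"
proof -
  have eul_X: "eul * X n = X n - X (n - 1)" for n
    by (simp add: eul_def left_diff_distrib flip: X_add)
  have eul_eul_X: "eul^2 * X n = X n - 2 * X (n - 1) + X (n - 2)" for n
    by (simp add: power2_eq_square mult.assoc eul_X right_diff_distrib)
  have two: "2 * chi0 n = chi0 n + chi0 n" for n
    by simp
  show "chi0 a * chi0 b = chi0 (a + b)" "chi0 a * chi1 b = chi1 (a + b)"
      "chi0 a * chi2 b = chi2 (a + b)"
    by (transfer; simp add: X_add)+
  show "chi1 a * chi2 b = chi0 (a + b) - 2 * chi0 (a + b - 1) + chi0 (a + b - 2)"
    unfolding two by transfer (simp add: eul_eul_X flip: X_add)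
  show "chi1 a * chi1 b = chi2 (a + b) - chi2 (a + b - 1)"
      "chi2 a * chi2 b = chi1 (a + b) - chi1 (a + b - 1)"
    by (transfer; simp add: eul_X flip: X_add)+
qed

global_interpretation KI: vector_space scaleKI
  by unfold_locales
    (transfer; auto simp: algebra_simps const_add const_mult)+

lemma scaleKI_mult: "(c *\<^sub>K x) * y = c *\<^sub>K (x * y)" "x * (c *\<^sub>K y) = c *\<^sub>K (x * y)"
  by (transfer; auto simp: algebra_simps)+


subsection \<open>Inertial Adams operations, lambda-line elements and the inertial dual\<close>

lemma X_diff_1_dvd: "X a - 1 dvd X (int l * a) - 1"
proof (induction l)
  case (Suc l)
  have "X (int (Suc l) * a) - 1 = X a * (X (int l * a) - 1) + (X a - 1)"
    by (simp add: algebra_simps flip: X_add)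
  then show ?case using Suc.IH by (metis dvd_add dvd_mult dvd_refl)
qed simp

lemma subst_power_rel_tw: "rel_tw dvd subst_power (int l) rel_tw"
  using X_diff_1_dvd[of 3 l] by (simp add: rel_tw_def subst_power_diff)

lemma subst_power_rel_untw: "rel_untw dvd subst_power (int l) rel_untw"
  using X_diff_1_dvd[of 3 l] X_diff_1_dvd[of 1 l]
  by (simp add: rel_untw_def subst_power_diff subst_power_mult mult_dvd_mono)

lemma subst_uminus_X_diff_1: "X a - 1 dvd subst_power (- 1) (X a - 1)"
proof -
  have "subst_power (- 1) (X a - 1) = (X a - 1) * (- X (- a))"
    by (simp add: subst_power_diff left_diff_distrib flip: X_add)
  then show ?thesis by simp
qed

lemma subst_uminus_rel_tw: "rel_tw dvd subst_power (- 1) rel_tw"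
  unfolding rel_tw_def by (rule subst_uminus_X_diff_1)

lemma subst_uminus_rel_untw: "rel_untw dvd subst_power (- 1) rel_untw"
  unfolding rel_untw_def subst_power_mult by (intro mult_dvd_mono subst_uminus_X_diff_1)

lemma dvd_subst_power_diff:
  assumes "r dvd subst_power n r" "r dvd f - g"
  shows "r dvd subst_power n f - subst_power n g"
proof -
  obtain h where "f - g = r * h" using assms(2) by (elim dvdE)
  then have "subst_power n f - subst_power n g = subst_power n r * subst_power n h"
    by (simp flip: subst_power_diff subst_power_mult)
  then show ?thesis using assms(1) by simp
qed

text \<open>Classical Adams operation, multiplied in the twisted sectors by the Bott class of the dual of
  the normal bundle.\<close>

lift_definition psi :: "nat \<Rightarrow> KI \<Rightarrow> KI" is
  "\<lambda>l (f0, f1, f2).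
     (subst_power (int l) f0,
      subst_power (int l) f1 * (\<Sum>i<l. X (- int i)),
      subst_power (int l) f2 * (\<Sum>i<l. X (- int i)))"
  by (auto intro!: dvd_diff_mult dvd_subst_power_diff subst_power_rel_tw subst_power_rel_untw)

text \<open>Exponential of a power series with vanishing constant term.  The \<open>k\<close>-th power has no terms
  below degree \<open>k\<close>, so the coefficient sums are finite; powers are taken for the virtual product.\<close>

definition exp_fps :: "KI fps \<Rightarrow> KI fps" where
  "exp_fps f = Abs_fps (\<lambda>n. \<Sum>k\<le>n. (1 / fact k) *\<^sub>K fps_nth (f ^ k) n)"

definition lambda_t :: "KI \<Rightarrow> KI fps" where
  "lambda_t V =
     exp_fps (Abs_fps (\<lambda>r. if r = 0 then 0 else ((- 1) ^ (r - 1) / of_nat r) *\<^sub>K psi r V))"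

definition lambda_line :: "KI \<Rightarrow> bool" where
  "lambda_line L \<longleftrightarrow> (\<exists>M. L * M = 1) \<and> lambda_t L = 1 + fps_X * fps_const L"

definition P1 :: "KI set" where
  "P1 = {L. lambda_line L}"

text \<open>Classical dual times the factor \<open>(-1)\<^bsup>rk\<^esup> \<cdot> det\<close> of the normal bundle, which is
  \<open>1\<close> in the untwisted sector and minus the character in the twisted ones.\<close>

lift_definition dagger :: "KI \<Rightarrow> KI" is
  "\<lambda>(f0, f1, f2).
     (subst_power (- 1) f0, subst_power (- 1) f1 * (- X 1), subst_power (- 1) f2 * (- X 1))"
  by (auto simp del: mult_minus_right intro!: dvd_diff_mult
      dvd_subst_power_diff subst_uminus_rel_tw subst_uminus_rel_untw)

lemma psi_chi:
  "psi l (chi0 a) = chi0 (int l * a)"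
  "psi l (chi1 a) = (\<Sum>i<l. chi1 (int l * a - int i))"
  "psi l (chi2 a) = (\<Sum>i<l. chi2 (int l * a - int i))"
proof -
  have sum1: "(\<Sum>i<n. chi1 (g i)) = abs_KI (0, \<Sum>i<n. X (g i), 0)" for n :: nat and g
    by (induction n) (simp_all add: zero_KI_def chi1.abs_eq plus_KI.abs_eq)
  have sum2: "(\<Sum>i<n. chi2 (g i)) = abs_KI (0, 0, \<Sum>i<n. X (g i))" for n :: nat and g
    by (induction n) (simp_all add: zero_KI_def chi2.abs_eq plus_KI.abs_eq)
  have X_diff: "X (b - c) = X b * X (- c)" for b c
    using X_add[of b "- c"] by simp
  show "psi l (chi0 a) = chi0 (int l * a)"
    by transfer simp
  show "psi l (chi1 a) = (\<Sum>i<l. chi1 (int l * a - int i))"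
    unfolding sum1 by (simp add: chi1.abs_eq psi.abs_eq X_diff sum_distrib_left)
  show "psi l (chi2 a) = (\<Sum>i<l. chi2 (int l * a - int i))"
    unfolding sum2 by (simp add: chi2.abs_eq psi.abs_eq X_diff sum_distrib_left)
qed

lemma dagger_chi:
  "dagger (chi0 a) = chi0 (- a)"
  "dagger (chi1 a) = - chi1 (1 - a)"
  "dagger (chi2 a) = - chi2 (1 - a)"
  by (transfer; simp flip: X_add)+


subsection \<open>The translation group and the orbit representatives\<close>

definition Delta0 :: KI where "Delta0 = chi0 3 - chi0 0"
definition Delta1 :: KI where "Delta1 = chi1 0 + chi1 1 + chi1 2"
definition Delta2 :: KI where "Delta2 = chi2 0 + chi2 1 + chi2 2"

definition J :: "KI set" where
  "J = KI.span {Delta0, Delta1, Delta2}"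

definition J_orbit :: "KI \<Rightarrow> KI set" where
  "J_orbit L = {v + L | v. v \<in> J}"

definition zeta3 :: complex where
  "zeta3 = exp (2 * of_real pi * \<i> / 3)"

definition Sigma_rep :: "nat \<Rightarrow> KI" where
  "Sigma_rep i = chi0 (int i - 1)"

text \<open>The families below are only used for indices \<open>i = 1, 2, 3\<close> and \<open>i = 1, \<dots>, 6\<close> respectively;
  the final branch of each case distinction is the last of these.\<close>

definition D_rep :: "nat \<Rightarrow> nat \<Rightarrow> KI" where
  "D_rep i j = (1/3) *\<^sub>K (
     if i = 1 then
       chi0 0 + chi0 1 + chi0 2 - zeta3^j *\<^sub>K chi1 0 + chi1 1 - zeta3^(2*j) *\<^sub>K chi2 0 + chi2 1
     else if i = 2 then
       chi0 0 + chi0 1 + chi0 2 - chi1 0 + zeta3^j *\<^sub>K chi1 1 - chi2 0 + zeta3^(2*j) *\<^sub>K chi2 1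
     else
       chi0 0 + chi0 1 + chi0 2 - zeta3^(2*j) *\<^sub>K chi1 0 + zeta3^j *\<^sub>K chi1 1
         - zeta3^j *\<^sub>K chi2 0 + zeta3^(2*j) *\<^sub>K chi2 1)"

definition T_rep :: "nat \<Rightarrow> nat \<Rightarrow> KI" where
  "T_rep i k = (1/3) *\<^sub>K (
     if i = 1 then
       chi0 0 + 2 *\<^sub>K chi0 2 + zeta3^k *\<^sub>K chi1 0 + zeta3^(2*k) *\<^sub>K chi2 0
     else if i = 2 then
       2 *\<^sub>K chi0 0 + chi0 2 - zeta3^k *\<^sub>K chi1 0 - zeta3^(2*k) *\<^sub>K chi2 0
     else if i = 3 then
       2 *\<^sub>K chi0 0 + chi0 1 + zeta3^k *\<^sub>K chi1 1 + zeta3^(2*k) *\<^sub>K chi2 1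
     else if i = 4 then
       chi0 0 + 2 *\<^sub>K chi0 1 - zeta3^k *\<^sub>K chi1 1 - zeta3^(2*k) *\<^sub>K chi2 1
     else if i = 5 then
       chi0 1 + 2 *\<^sub>K chi0 2 + zeta3^k *\<^sub>K chi1 0 + zeta3^k *\<^sub>K chi1 1
         + zeta3^(2*k) *\<^sub>K chi2 0 + zeta3^(2*k) *\<^sub>K chi2 1
     else
       2 *\<^sub>K chi0 1 + chi0 2 - zeta3^k *\<^sub>K chi1 0 - zeta3^k *\<^sub>K chi1 1
         - zeta3^(2*k) *\<^sub>K chi2 0 - zeta3^(2*k) *\<^sub>K chi2 1)"

definition Sigma_reps :: "KI set" where
  "Sigma_reps = Sigma_rep ` {1..3}"

definition D_reps :: "KI set" where
  "D_reps = (\<lambda>(i, j). D_rep i j) ` ({1..3} \<times> {1..2})"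

definition T_reps :: "KI set" where
  "T_reps = (\<lambda>(i, k). T_rep i k) ` ({1..6} \<times> {0..2})"

end

theory Submission
  imports Defs
begin

text \<open>The ring of virtual K-theory classes is a ten-dimensional complex algebra, and the proof reads off
the \<open>\<lambda>\<close>-line elements from its points.  Over a cube root of unity \<open>w \<noteq> 1\<close> the Euler class
\<open>e = 1 - w\<^sup>-\<^sup>1\<close> of the twisted sectors is invertible, and rescaling the twisted components by \<open>e\<close>
turns the fibre of the virtual product into the group ring of the cyclic group of order three.  Its
characters \<open>s \<in> {1, \<zeta>, \<zeta>\<^sup>2}\<close> give the points \<open>(w, s)\<close>, with ring homomorphisms
\<open>(f\<^sub>0, f\<^sub>1, f\<^sub>2) \<mapsto> f\<^sub>0(w) + s e f\<^sub>1(w) + s\<^sup>2 e f\<^sub>2(w)\<close> (\<open>point_char\<close>).  Over \<open>w = 1\<close> the Euler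
class vanishes; all \<open>s\<close> give the same point there, and the fibre is a local ring whose maximal
ideal has square zero and is spanned by three tangent directions (\<open>tangent\<close>): the derivative
of \<open>f\<^sub>0\<close> at \<open>1\<close>, and the values \<open>f\<^sub>1(1)\<close> and \<open>f\<^sub>2(1)\<close>.  So there are seven points, the common
kernel of all the characters is exactly the translation group \<open>J\<close> (\<open>mem_J_iff\<close>), and characters and
tangent functionals together separate elements (\<open>KI_eqI\<close>).

In these coordinates the remaining structure becomes transparent.  The Bott class in the
definition of the inertial Adams operation is \<open>(1 - w\<^sup>-\<^sup>l) / (1 - w\<^sup>-\<^sup>1)\<close>, so the operation simply moves
the point \<open>(w, s)\<close> to \<open>(w\<^sup>l, s)\<close> and multiplies tangent coordinates by \<open>l\<close>; likewise the
inertial dual moves \<open>(w, s)\<close> to \<open>(w\<^sup>-\<^sup>1, s)\<close> and negates tangent coordinates.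

Comparing logarithmic derivatives, \<open>\<lambda>\<^sub>t(L) = 1 + tL\<close> means that \<open>\<psi>\<^sup>r(L) = L\<^sup>r\<close> for all \<open>r \<ge> 1\<close>
(\<open>lambda_t_eq_iff\<close>).  On tangent coordinates this is automatic as soon as \<open>L\<close> has value \<open>1\<close> at the
point over \<open>w = 1\<close>; on points it says that the value of \<open>L\<close> at \<open>(\<zeta>\<^sup>r, s)\<close> is the \<open>r\<close>-th power of its
value at \<open>(\<zeta>, s)\<close> (\<open>P1_iff\<close>).  Hence a \<open>\<lambda>\<close>-line element amounts to three freely chosen cube roots of
unity, one for each \<open>s\<close>, together with an arbitrary translation by \<open>J\<close>: there are \<open>3\<^sup>3 = 27\<close>
orbits, and the dual is the inverse because inverse and dual have the same values and tangent
coordinates.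

The listed representatives realise the 27 triples as follows: \<open>Sigma\<close> gives the three constant triples,
\<open>D\<close> the six triples with distinct entries, and \<open>T\<close> the eighteen triples in which
exactly one entry differs from the other two.  As 27 triples are reached by at most
\<open>3 + 6 + 18\<close> elements, uniqueness, injectivity and disjointness all follow by counting.\<close>

section \<open>Evaluation and derivative of Laurent polynomials\<close>

definition lin_ext :: "(int \<Rightarrow> complex) \<Rightarrow> laurent \<Rightarrow> complex" where
  "lin_ext h f = (\<Sum>a\<in>Poly_Mapping.keys f. Poly_Mapping.lookup f a * h a)"

lemma lin_ext_superset:
  assumes "finite A" "Poly_Mapping.keys f \<subseteq> A"
  shows "lin_ext h f = (\<Sum>a\<in>A. Poly_Mapping.lookup f a * h a)"
  unfolding lin_ext_def
  by (rule sum.mono_neutral_left) (use assms in \<open>auto simp: in_keys_iff\<close>)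

lemma lin_ext_add: "lin_ext h (f + g) = lin_ext h f + lin_ext h g"
proof -
  let ?A = "Poly_Mapping.keys f \<union> Poly_Mapping.keys g"
  have "lin_ext h (f + g) = (\<Sum>a\<in>?A. Poly_Mapping.lookup (f + g) a * h a)"
    by (rule lin_ext_superset) (use Poly_Mapping.keys_add[of f g] in auto)
  also have "\<dots> = lin_ext h f + lin_ext h g"
    by (simp add: lookup_add distrib_right sum.distrib
        lin_ext_superset[of ?A f] lin_ext_superset[of ?A g])
  finally show ?thesis .
qed

lemma lin_ext_single [simp]: "lin_ext h (Poly_Mapping.single a c) = c * h a"
  by (cases "c = 0") (simp_all add: lin_ext_def)

lemma lin_ext_uminus: "lin_ext h (- f) = - lin_ext h f"
  by (simp add: lin_ext_def sum_negf)

lemma lin_ext_diff: "lin_ext h (f - g) = lin_ext h f - lin_ext h g"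
  using lin_ext_add[of h f "- g"] by (simp add: lin_ext_uminus)

definition eval_at :: "complex \<Rightarrow> laurent \<Rightarrow> complex" where
  "eval_at w = lin_ext (\<lambda>a. w powi a)"

definition deriv_at_1 :: "laurent \<Rightarrow> complex" where
  "deriv_at_1 = lin_ext of_int"

lemma eval_at_simps [simp]:
  "eval_at w (X a) = w powi a" "eval_at w (const c) = c" "eval_at w 0 = 0" "eval_at w 1 = 1"
  "eval_at w (f + g) = eval_at w f + eval_at w g"
  "eval_at w (f - g) = eval_at w f - eval_at w g"
  "eval_at w (- f) = - eval_at w f"
  using lin_ext_single[of "\<lambda>a. w powi a" 0 1]
  by (simp_all add: eval_at_def X_def const_def lin_ext_add lin_ext_diff lin_ext_uminus
      lin_ext_def[of _ 0])

lemma deriv_at_1_simps [simp]: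
  "deriv_at_1 (X a) = of_int a" "deriv_at_1 (const c) = 0" "deriv_at_1 0 = 0" "deriv_at_1 1 = 0"
  "deriv_at_1 (f + g) = deriv_at_1 f + deriv_at_1 g"
  "deriv_at_1 (f - g) = deriv_at_1 f - deriv_at_1 g"
  using lin_ext_single[of of_int 0 1]
  by (simp_all add: deriv_at_1_def X_def const_def lin_ext_add lin_ext_diff
      lin_ext_def[of _ 0])

lemma eval_at_mult [simp]:
  assumes "w \<noteq> 0"
  shows "eval_at w (f * g) = eval_at w f * eval_at w g"
proof (induction f rule: laurent_induct)
  case (single a c)
  show ?case
    using assms
    by (induction g rule: laurent_induct)
      (simp_all add: eval_at_def mult_single lin_ext_add algebra_simps power_int_add)
qed (simp add: distrib_right)

lemma deriv_at_1_mult [simp]: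
  "deriv_at_1 (f * g) = eval_at 1 f * deriv_at_1 g + deriv_at_1 f * eval_at 1 g"
proof (induction f rule: laurent_induct)
  case (single a c)
  show ?case
    by (induction g rule: laurent_induct)
      (simp_all add: eval_at_def deriv_at_1_def mult_single lin_ext_add algebra_simps)
qed (simp add: distrib_right)

lemma eval_at_sum [simp]: "eval_at w (\<Sum>i\<in>A. f i) = (\<Sum>i\<in>A. eval_at w (f i))"
  by (induction A rule: infinite_finite_induct) simp_all

lemma eval_at_subst_power [simp]: "eval_at w (subst_power n f) = eval_at (w powi n) f"
  by (induction f rule: laurent_induct)
    (simp_all add: subst_power_add eval_at_def lin_ext_add power_int_mult)

lemma deriv_at_1_subst_power [simp]: "deriv_at_1 (subst_power n f) = of_int n * deriv_at_1 f"
  by (induction f rule: laurent_induct)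
    (simp_all add: subst_power_add deriv_at_1_def lin_ext_add algebra_simps)

text \<open>The congruences defining the sectors are invisible to evaluation at a root of the modulus; the
double root \<open>1\<close> of \<open>rel_untw\<close> makes the derivative at \<open>1\<close> well defined as well.\<close>

lemma eval_at_cong: "r dvd f - g \<Longrightarrow> w \<noteq> 0 \<Longrightarrow> eval_at w r = 0 \<Longrightarrow> eval_at w f = eval_at w g"
  by (elim dvdE) (metis eval_at_mult eval_at_simps(6) mult_zero_left right_minus_eq)

lemma deriv_at_1_cong: "rel_untw dvd f - g \<Longrightarrow> deriv_at_1 f = deriv_at_1 g"
proof (elim dvdE)
  fix h assume "f - g = rel_untw * h"
  then have "deriv_at_1 (f - g) = deriv_at_1 (rel_untw * h)" by simp
  then show ?thesis by (simp add: rel_untw_def)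
qed

section \<open>Cube roots of unity\<close>

lemma zeta3_nonzero [simp]: "zeta3 \<noteq> 0"
  by (simp add: zeta3_def)

lemma zeta3_cubed: "zeta3 ^ 3 = 1"
proof -
  have "zeta3 = cis (2 * pi / 3)"
    by (simp add: zeta3_def cis_conv_exp mult_ac)
  then have "zeta3 ^ 3 = cis (2 * pi / 3) ^ 3" by (rule arg_cong)
  also have "\<dots> = cis (real 3 * (2 * pi / 3))" by (rule DeMoivre)
  finally show ?thesis by simp
qed

lemma zeta3_neq_1: "zeta3 \<noteq> 1"
proof
  assume "zeta3 = 1"
  then have "cos (2 * pi / 3) = 1"
    by (simp add: zeta3_def exp_eq_polar complex_eq_iff Re_exp)
  then show False by (simp add: cos_120)
qed

lemma zeta3_sum: "1 + zeta3 + zeta3\<^sup>2 = 0"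
proof -
  have "(zeta3 - 1) * (1 + zeta3 + zeta3\<^sup>2) = 0"
    using zeta3_cubed by (simp add: algebra_simps power2_eq_square power3_eq_cube)
  then show ?thesis using zeta3_neq_1 by simp
qed

text \<open>As rewrite rules these bring polynomials in \<open>\<zeta>\<close> into the normal form \<open>a + b\<zeta>\<close>; the second rule
applies the first inside right-nested products.\<close>

lemma zeta3_square: "zeta3 * zeta3 = - 1 - zeta3" "zeta3 * (zeta3 * c) = - c - zeta3 * c"
proof -
  show *: "zeta3 * zeta3 = - 1 - zeta3"
    using zeta3_sum by (simp add: power2_eq_square algebra_simps eq_neg_iff_add_eq_0)
  show "zeta3 * (zeta3 * c) = - c - zeta3 * c"
    by (metis * left_diff_distrib mult.assoc mult_minus1)
qed

lemma zeta3_power_mod: "zeta3 ^ (n mod 3) = zeta3 ^ n"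
proof -
  have "zeta3 ^ n = zeta3 ^ (3 * (n div 3) + n mod 3)" by simp
  also have "\<dots> = zeta3 ^ (n mod 3)" unfolding power_add power_mult zeta3_cubed by simp
  finally show ?thesis by simp
qed

lemma zeta3_numeral_power:
  "zeta3 ^ 2 = - 1 - zeta3" "zeta3 ^ 3 = 1" "zeta3 ^ 4 = zeta3" "zeta3 ^ 6 = 1"
  using zeta3_power_mod[of 3] zeta3_power_mod[of 4] zeta3_power_mod[of 6]
  by (simp_all add: power2_eq_square zeta3_square)

lemma zeta3_power_cong: "m mod 3 = n mod 3 \<Longrightarrow> zeta3 ^ m = zeta3 ^ n"
  by (metis zeta3_power_mod)

lemma zeta3_power_cubed [simp]: "(zeta3 ^ n) ^ 3 = 1"
  by (metis mult.commute power_mult power_one zeta3_cubed)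

lemma zeta3_inverse: "inverse zeta3 = zeta3\<^sup>2"
  using zeta3_cubed by (intro inverse_unique) (simp add: power2_eq_square power3_eq_cube mult.assoc)

lemma zeta3_power_inverse: "inverse (zeta3 ^ i) = zeta3 ^ (2 * i)"
  by (simp add: zeta3_inverse power_mult flip: power_inverse)

text \<open>A quadratic polynomial that vanishes at the three cube roots of unity is zero.  This is used twice
over, in the variable \<open>s\<close> of a point \<open>(w, s)\<close> and then in \<open>w\<close>.\<close>

lemma zeta3_quadratic_zero:
  assumes "\<And>n. a + b * zeta3 ^ n + c * zeta3 ^ (2 * n) = 0"
  shows "a = 0" "b = 0" "c = 0"
proof -
  have *: "a + b + c = 0" "a + b * zeta3 + c * (- 1 - zeta3) = 0"
    "a + b * (- 1 - zeta3) + c * zeta3 = 0"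
    using assms[of 0] assms[of 1] assms[of 2]
    by (simp_all add: eval_nat_numeral algebra_simps zeta3_square)
  then have "3 * a = 0" by algebra
  then show "a = 0" by simp
  with * have "b * (1 + 2 * zeta3) = 0" by algebra
  moreover have "1 + 2 * zeta3 \<noteq> 0"
  proof
    assume h: "1 + 2 * zeta3 = 0"
    have "(1 + 2 * zeta3) * (1 + 2 * zeta3) = - 3"
      by (simp add: algebra_simps zeta3_square)
    with h show False by simp
  qed
  ultimately show "b = 0" by simp
  with * \<open>a = 0\<close> show "c = 0" by simp
qed

definition cube_roots :: "complex set" where "cube_roots = {1, zeta3, zeta3\<^sup>2}"

lemma mem_cube_roots_iff: "z \<in> cube_roots \<longleftrightarrow> z ^ 3 = 1"
proof
  assume z: "z ^ 3 = 1"
  have sum: "zeta3\<^sup>2 + zeta3 + 1 = 0" using zeta3_sum by (simp add: add_ac)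
  have "(z - 1) * (z - zeta3) * (z - zeta3\<^sup>2)
      = z ^ 3 - zeta3 ^ 3 + (zeta3\<^sup>2 + zeta3 + 1) * (z * zeta3 - z\<^sup>2)"
    by (simp add: algebra_simps power2_eq_square power3_eq_cube)
  also have "\<dots> = 0" unfolding sum zeta3_cubed z by simp
  finally show "z \<in> cube_roots" by (auto simp: cube_roots_def)
next
  have "(zeta3\<^sup>2) ^ 3 = 1" by (rule zeta3_power_cubed)
  then show "z ^ 3 = 1" if "z \<in> cube_roots"
    using that zeta3_cubed unfolding cube_roots_def
    by (elim insertE emptyE) (simp_all only: power_one)
qed

lemma card_cube_roots: "card cube_roots = 3"
proof -
  have "zeta3\<^sup>2 \<noteq> 1"
  proof
    assume "zeta3\<^sup>2 = 1"
    then have "zeta3 ^ 3 = zeta3" by (simp add: power2_eq_square power3_eq_cube)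
    then show False using zeta3_cubed zeta3_neq_1 by simp
  qed
  moreover have "zeta3\<^sup>2 \<noteq> zeta3" using zeta3_neq_1 by (simp add: power2_eq_square)
  ultimately show ?thesis using zeta3_neq_1 by (simp add: cube_roots_def)
qed

section \<open>The exponential series and Adams operations of lambda-line elements\<close>

lemma of_nat_mult_eq_scale: "of_nat n * (x :: KI) = of_nat n *\<^sub>K x"
  by (induction n) (simp_all add: distrib_right KI.scale_left_distrib)

lemma of_nat_Suc_mult_cancel:
  assumes "of_nat (Suc n) * (x :: KI) = of_nat (Suc n) * y"
  shows "x = y"
  using assms KI.scale_left_imp_eq[of "of_nat (Suc n)" x y] unfolding of_nat_mult_eq_scale
  by (simp del: of_nat_Suc)

text \<open>The chain rule for the exponential, coefficientwise: differentiating the \<open>k\<close>-th power cancels one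
factor of \<open>k!\<close>, and powers beyond the degree contribute nothing, so that the truncations of the sums
on the two sides agree.\<close>

lemma deriv_exp_fps:
  assumes "fps_nth f 0 = 0"
  shows "fps_deriv (exp_fps f) = fps_deriv f * exp_fps f"
proof (rule fps_ext)
  fix n
  have pow: "fps_nth (f ^ k) m = 0" if "m < k" for k m
    using startsby_zero_power_prefix[OF assms] that by blast
  have "fps_nth (fps_deriv (exp_fps f)) n
      = (\<Sum>k\<le>Suc n. (1 / fact k) *\<^sub>K fps_nth (fps_deriv (f ^ k)) n)"
    by (simp add: exp_fps_def sum_distrib_left scaleKI_mult del: sum.atMost_Suc of_nat_Suc)
  also have "\<dots> = (\<Sum>k\<le>n. (1 / fact (Suc k)) *\<^sub>K fps_nth (fps_deriv (f ^ Suc k)) n)"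
    by (subst sum.atMost_Suc_shift) simp
  also have "\<dots> = (\<Sum>k\<le>n. (1 / fact k) *\<^sub>K fps_nth (fps_deriv f * f ^ k) n)"
  proof (rule sum.cong)
    fix k
    have "fps_nth (fps_deriv (f ^ Suc k)) n = of_nat (Suc k) *\<^sub>K fps_nth (fps_deriv f * f ^ k) n"
      unfolding fps_deriv_power of_nat_mult_eq_scale[symmetric] by (simp add: mult.assoc)
    then show "(1 / fact (Suc k)) *\<^sub>K fps_nth (fps_deriv (f ^ Suc k)) n
        = (1 / fact k) *\<^sub>K fps_nth (fps_deriv f * f ^ k) n"
      by (simp add: divide_simps del: fps_deriv_nth of_nat_Suc)
  qed simp
  also have "\<dots> = (\<Sum>k\<le>n. \<Sum>i=0..n.
      fps_nth (fps_deriv f) i * ((1 / fact k) *\<^sub>K fps_nth (f ^ k) (n - i)))"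
    by (simp add: fps_mult_nth KI.scale_sum_right scaleKI_mult del: fps_deriv_nth)
  also have "\<dots> = (\<Sum>i=0..n.
      fps_nth (fps_deriv f) i * (\<Sum>k\<le>n. (1 / fact k) *\<^sub>K fps_nth (f ^ k) (n - i)))"
    by (subst sum.swap) (simp add: sum_distrib_left del: fps_deriv_nth)
  also have "\<dots> = (\<Sum>i=0..n. fps_nth (fps_deriv f) i * fps_nth (exp_fps f) (n - i))"
  proof (rule sum.cong)
    fix i
    have "(\<Sum>k\<le>n. (1 / fact k) *\<^sub>K fps_nth (f ^ k) (n - i))
      = (\<Sum>k\<le>n - i. (1 / fact k) *\<^sub>K fps_nth (f ^ k) (n - i))"
      by (rule sum.mono_neutral_right) (auto simp: pow)
    then show "fps_nth (fps_deriv f) i * (\<Sum>k\<le>n. (1 / fact k) *\<^sub>K fps_nth (f ^ k) (n - i))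
        = fps_nth (fps_deriv f) i * fps_nth (exp_fps f) (n - i)"
      by (simp add: exp_fps_def)
  qed simp
  finally show "fps_nth (fps_deriv (exp_fps f)) n = fps_nth (fps_deriv f * exp_fps f) n"
    by (simp add: fps_mult_nth)
qed

text \<open>The equation determines \<open>(n + 1) E\<^sub>n\<^sub>+\<^sub>1\<close> from earlier coefficients, and positive integers can be
cancelled because scalars are complex.\<close>

lemma fps_linear_ode_unique:
  fixes g :: "KI fps"
  assumes "fps_deriv E = g * E" "fps_deriv F = g * F" "fps_nth E 0 = fps_nth F 0"
  shows "E = F"
proof (rule fps_ext)
  fix n show "fps_nth E n = fps_nth F n"
  proof (induction n rule: less_induct)
    case (less n)
    show ?case
    proof (cases n)
      case 0 then show ?thesis using assms by simp
    next
      case (Suc m)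
      have "fps_nth (fps_deriv E) m = fps_nth (fps_deriv F) m"
        unfolding assms fps_mult_nth using less Suc by (intro sum.cong) auto
      then show ?thesis using of_nat_Suc_mult_cancel[of m] Suc by simp
    qed
  qed
qed

text \<open>Both sides of \<open>exp f = 1 + tL\<close> have constant term \<open>1\<close>, so they agree if and only if \<open>1 + tL\<close> solves the
differential equation \<open>F' = f' F\<close> of the exponential.  Since \<open>f'\<close> has coefficients
\<open>(-1)\<^sup>n \<psi>\<^sup>n\<^sup>+\<^sup>1(L)\<close>, this amounts to the recursion \<open>\<psi>\<^sup>1(L) = L\<close>, \<open>\<psi>\<^sup>n\<^sup>+\<^sup>1(L) = \<psi>\<^sup>n(L) L\<close>.\<close>

lemma lambda_t_eq_iff:
  "lambda_t L = 1 + fps_X * fps_const L \<longleftrightarrow> (\<forall>r>0. psi r L = L ^ r)"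
proof -
  define f where
    "f = Abs_fps (\<lambda>r. if r = 0 then 0 else ((- 1) ^ (r - 1) / of_nat r) *\<^sub>K psi r L)"
  define F where "F = 1 + fps_X * fps_const L"
  have exp: "lambda_t L = exp_fps f" by (simp add: lambda_t_def f_def)
  have ode: "fps_deriv (exp_fps f) = fps_deriv f * exp_fps f"
    by (rule deriv_exp_fps) (simp add: f_def)
  have E0: "fps_nth (exp_fps f) 0 = fps_nth F 0"
    by (simp add: exp_fps_def F_def)
  have F': "fps_deriv F = fps_const L" by (simp add: F_def)
  have sgn: "((- 1) ^ n :: complex) *\<^sub>K x = (- 1) ^ n * x" for n x
    by (induction n) (simp_all add: scaleKI_mult)
  have f': "fps_nth (fps_deriv f) n = (- 1) ^ n * psi (Suc n) L" for n
  proof -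
    have "fps_nth (fps_deriv f) n = ((- 1) ^ n) *\<^sub>K psi (Suc n) L"
      unfolding fps_deriv_nth of_nat_mult_eq_scale
      by (simp add: f_def del: of_nat_Suc)
    then show ?thesis using sgn by simp
  qed
  have f'F: "fps_nth (fps_deriv f * F) n
      = (if n = 0 then psi 1 L else (- 1) ^ n * (psi (Suc n) L - psi n L * L))" for n
  proof -
    have "fps_deriv f * F = fps_deriv f + fps_X * (fps_deriv f * fps_const L)"
      by (simp add: F_def algebra_simps)
    then have "fps_nth (fps_deriv f * F) n = fps_nth (fps_deriv f) n +
        (if n = 0 then 0 else fps_nth (fps_deriv f) (n - 1) * L)"
      by (simp del: fps_deriv_nth)
    then show ?thesis unfolding f' by (cases n) (simp_all add: algebra_simps)
  qed
  have "exp_fps f = F \<longleftrightarrow> fps_deriv F = fps_deriv f * F"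
    using ode E0 fps_linear_ode_unique by metis
  also have "\<dots> \<longleftrightarrow> (\<forall>n. fps_nth (fps_deriv f * F) n = (if n = 0 then L else 0))"
    by (auto simp: F' fps_eq_iff simp del: fps_deriv_nth)
  also have "\<dots> \<longleftrightarrow> psi 1 L = L \<and> (\<forall>n>0. psi (Suc n) L = psi n L * L)"
  proof -
    have "(- 1) ^ n * x = 0 \<longleftrightarrow> x = 0" for n and x :: KI
      by (cases "even n") simp_all
    then show ?thesis unfolding f'F by (auto split: if_splits)
  qed
  also have "\<dots> \<longleftrightarrow> (\<forall>r>0. psi r L = L ^ r)"
  proof (intro iffI conjI allI impI)
    fix r :: nat assume h: "psi 1 L = L \<and> (\<forall>n>0. psi (Suc n) L = psi n L * L)" "r > 0"
    from h(2) show "psi r L = L ^ r"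
      by (induction r rule: nat_induct_non_zero) (use h(1) in \<open>simp_all add: mult.commute\<close>)
  qed (simp_all add: mult.commute)
  finally show ?thesis by (simp add: exp F_def)
qed

section \<open>Points and tangent directions of the virtual K-theory ring\<close>

text \<open>The character attached to the point \<open>(w, s) = (\<zeta>\<^sup>i, \<zeta>\<^sup>t)\<close>.  Points are indexed by exponents rather than by
roots of unity so that the function is defined on all classes without a side condition; the factor
\<open>1 - \<zeta>\<^sup>2\<^sup>i\<close> is the value \<open>1 - w\<^sup>-\<^sup>1\<close> of the Euler class.\<close>

lift_definition point_char :: "nat \<Rightarrow> nat \<Rightarrow> KI \<Rightarrow> complex" is
  "\<lambda>i t (f0, f1, f2). eval_at (zeta3 ^ i) f0
     + zeta3 ^ t * ((1 - zeta3 ^ (2 * i)) * eval_at (zeta3 ^ i) f1)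
     + zeta3 ^ (2 * t) * ((1 - zeta3 ^ (2 * i)) * eval_at (zeta3 ^ i) f2)"
proof clarsimp
  fix i f0 f1 f2 g0 g1 g2
  assume dvd: "rel_untw dvd f0 - g0" "rel_tw dvd f1 - g1" "rel_tw dvd f2 - g2"
  have "eval_at (zeta3 ^ i) rel_tw = 0" "eval_at (zeta3 ^ i) rel_untw = 0"
    by (simp_all add: rel_tw_def rel_untw_def)
  with dvd show "eval_at (zeta3 ^ i) f0
     + zeta3 ^ t * ((1 - zeta3 ^ (2 * i)) * eval_at (zeta3 ^ i) f1)
     + zeta3 ^ (2 * t) * ((1 - zeta3 ^ (2 * i)) * eval_at (zeta3 ^ i) f2)
   = eval_at (zeta3 ^ i) g0
     + zeta3 ^ t * ((1 - zeta3 ^ (2 * i)) * eval_at (zeta3 ^ i) g1)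
     + zeta3 ^ (2 * t) * ((1 - zeta3 ^ (2 * i)) * eval_at (zeta3 ^ i) g2)" for t
    by (simp add: eval_at_cong[of rel_untw f0 g0] eval_at_cong[of rel_tw f1 g1]
        eval_at_cong[of rel_tw f2 g2])
qed

text \<open>One functional for each sector, indexed by \<open>m = 0, 1, 2\<close> (all \<open>m \<ge> 2\<close> stand for the last sector).\<close>

lift_definition tangent :: "nat \<Rightarrow> KI \<Rightarrow> complex" is
  "\<lambda>m (f0, f1, f2). if m = 0 then deriv_at_1 f0 else if m = 1 then eval_at 1 f1 else eval_at 1 f2"
proof -
  have "eval_at 1 rel_tw = 0" by (simp add: rel_tw_def)
  then show "?thesis m x y" if "sector_eq x y" for m x y
    using that by (cases x; cases y) (auto dest: deriv_at_1_cong eval_at_cong[where w = 1])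
qed

lemma point_char_simps [simp]:
  "point_char i t 0 = 0" "point_char i t 1 = 1"
  "point_char i t (x + y) = point_char i t x + point_char i t y"
  "point_char i t (x - y) = point_char i t x - point_char i t y"
  "point_char i t (- x) = - point_char i t x"
  "point_char i t (c *\<^sub>K x) = c * point_char i t x"
  by (transfer; auto simp: algebra_simps)+

lemma point_char_chi [simp]:
  "point_char i t (chi0 a) = (zeta3 ^ i) powi a"
  "point_char i t (chi1 a) = zeta3 ^ t * (1 - zeta3 ^ (2 * i)) * (zeta3 ^ i) powi a"
  "point_char i t (chi2 a) = zeta3 ^ (2 * t) * (1 - zeta3 ^ (2 * i)) * (zeta3 ^ i) powi a"
  by (transfer; simp)+

lemma eval_at_eul: "eval_at (zeta3 ^ i) eul = 1 - zeta3 ^ (2 * i)"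
  by (simp add: eul_def power_int_minus zeta3_power_inverse)

lemma point_char_cong: "zeta3 ^ i = zeta3 ^ j \<Longrightarrow> point_char i t x = point_char j t x"
  by transfer (auto simp: mult.commute[of 2] power_mult)

lemma KI_cases:
  obtains f0 f1 f2 where "x = abs_KI (f0, f1, f2)"
  by (metis Quotient3_KI Quotient3_def prod_cases3)

text \<open>After the twisted components are scaled by \<open>e\<close>, the virtual product is multiplication in the group ring of
the cyclic group of order three, with generator sent to \<open>s\<close> by the character.\<close>

lemma cyclic_group_ring_char:
  fixes s s2 e f0 f1 f2 g0 g1 g2 :: complex
  assumes "s * s = s2" "s * s2 = 1" "s2 * s2 = s"
  shows "(f0 + s * (e * f1) + s2 * (e * f2)) * (g0 + s * (e * g1) + s2 * (e * g2))
    = f0 * g0 + e\<^sup>2 * (f1 * g2 + f2 * g1)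
      + s * (e * (f0 * g1 + f1 * g0 + e * (f2 * g2)))
      + s2 * (e * (f0 * g2 + f2 * g0 + e * (f1 * g1)))"
  by (simp add: algebra_simps power2_eq_square assms)

lemma point_char_mult [simp]: "point_char i t (x * y) = point_char i t x * point_char i t y"
proof -
  obtain f0 f1 f2 where x: "x = abs_KI (f0, f1, f2)" by (rule KI_cases)
  obtain g0 g1 g2 where y: "y = abs_KI (g0, g1, g2)" by (rule KI_cases)
  define s s2 where "s = zeta3 ^ t" and "s2 = zeta3 ^ (2 * t)"
  have 1: "s * s = s2" by (simp add: s_def s2_def mult_2 power_add)
  have 2: "s * s2 = 1"
    using zeta3_power_cubed[of t]
    by (simp add: s_def s2_def mult_2 power_add power3_eq_cube mult.assoc)
  have 3: "s2 * s2 = s" using 1 2 by (metis mult.assoc mult.right_neutral)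
  show ?thesis
    unfolding x y times_KI.abs_eq point_char.abs_eq case_prod_conv
    unfolding s_def[symmetric] s2_def[symmetric] cyclic_group_ring_char[OF 1 2 3]
    by (simp add: eval_at_eul power2_eq_square)
qed

lemma point_char_power [simp]: "point_char i t (x ^ n) = point_char i t x ^ n"
  by (induction n) simp_all

text \<open>Multiplying the geometric sum of the Bott class by the Euler class \<open>1 - w\<^sup>-\<^sup>1\<close> telescopes to
\<open>1 - w\<^sup>-\<^sup>l\<close>, which is the Euler class at \<open>w\<^sup>l\<close>.\<close>

lemma point_char_psi [simp]: "point_char i t (psi l x) = point_char (l * i) t x"
proof -
  obtain f0 f1 f2 where x: "x = abs_KI (f0, f1, f2)" by (rule KI_cases)
  have "(1 - zeta3 ^ (2 * i)) * (\<Sum>j<l. (zeta3 ^ i) powi (- int j)) = 1 - zeta3 ^ (2 * (l * i))"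
  proof -
    have "(zeta3 ^ i) powi (- int j) = (zeta3 ^ (2 * i)) ^ j" for j
      by (simp only: power_int_minus power_int_of_nat power_inverse flip: zeta3_power_inverse)
    then show ?thesis
      by (simp only: one_diff_power_eq[symmetric]) (simp add: mult_ac flip: power_mult)
  qed
  moreover have "(zeta3 ^ i) powi int l = zeta3 ^ (l * i)"
    by (simp add: power_mult[symmetric] mult.commute)
  ultimately show ?thesis
    unfolding x psi.abs_eq point_char.abs_eq case_prod_conv by (simp add: mult_ac)
qed

text \<open>The twist by \<open>-w\<close> in the dual turns the Euler class \<open>1 - w\<^sup>-\<^sup>1\<close> at \<open>w\<close> into the one at \<open>w\<^sup>-\<^sup>1\<close>, because
\<open>-w (1 - w\<^sup>-\<^sup>1) = 1 - w\<close>.  In exponents, inversion is doubling.\<close>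

lemma point_char_dagger [simp]: "point_char i t (dagger x) = point_char (2 * i) t x"
proof -
  obtain f0 f1 f2 where x: "x = abs_KI (f0, f1, f2)" by (rule KI_cases)
  have "zeta3 ^ (2 * i) * zeta3 ^ i = 1"
    using zeta3_power_cubed[of i] by (simp add: power3_eq_cube mult_2 power_add)
  moreover have "zeta3 ^ (2 * (2 * i)) = zeta3 ^ i"
  proof -
    have "2 * (2 * i) = i * 3 + i" by simp
    then show ?thesis by (simp only: power_add power_mult zeta3_power_cubed mult_1)
  qed
  ultimately have "(1 - zeta3 ^ (2 * i)) * (- (zeta3 ^ i)) = 1 - zeta3 ^ (2 * (2 * i))"
    by (simp add: algebra_simps)
  then have "(1 - zeta3 ^ (2 * i)) * (y * - (zeta3 ^ i)) = (1 - zeta3 ^ (2 * (2 * i))) * y" for y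
    by (metis mult.assoc mult.commute)
  moreover have "eval_at (zeta3 ^ i) (subst_power (- 1) f) = eval_at (zeta3 ^ (2 * i)) f"
    "eval_at (zeta3 ^ i) (subst_power (- 1) f * - X 1) = eval_at (zeta3 ^ (2 * i)) f * - (zeta3 ^ i)"
    for f
    by (simp_all add: power_int_minus zeta3_power_inverse)
  ultimately show ?thesis
    unfolding x dagger.abs_eq point_char.abs_eq case_prod_conv by (simp only:)
qed

lemma tangent_simps [simp]:
  "tangent m 0 = 0" "tangent m 1 = 0"
  "tangent m (x + y) = tangent m x + tangent m y"
  "tangent m (x - y) = tangent m x - tangent m y"
  "tangent m (c *\<^sub>K x) = c * tangent m x"
  by (transfer; auto simp: algebra_simps)+

text \<open>The Euler class vanishes at \<open>1\<close>, and its square vanishes there to second order; hence products of two twisted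
classes do not contribute, and what is left of the virtual product satisfies the Leibniz rule.\<close>

lemma tangent_mult:
  "tangent m (x * y) = point_char 0 0 x * tangent m y + tangent m x * point_char 0 0 y"
  by transfer (auto simp: eul_def power2_eq_square)

lemma tangent_power:
  "point_char 0 0 x = 1 \<Longrightarrow> tangent m (x ^ n) = of_nat n * tangent m x"
  by (induction n) (simp_all add: tangent_mult algebra_simps)

lemma tangent_psi [simp]: "tangent m (psi l x) = of_nat l * tangent m x"
  by transfer auto

lemma tangent_dagger [simp]: "tangent m (dagger x) = - tangent m x"
  by transfer auto

section \<open>Characters and tangent functionals separate elements\<close>

text \<open>Multiplication by \<open>\<chi>\<^sub>0\<close> fixes \<open>\<Delta>\<^sub>0 = \<chi>\<^sub>0\<^sup>3 - 1\<close>, since \<open>(\<chi>\<^sub>0 - 1)(\<chi>\<^sub>0\<^sup>3 - 1) = 0\<close>; so a shift of the exponent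
by three adds \<open>\<Delta>\<^sub>0\<close> in the untwisted sector and changes nothing in the twisted ones.\<close>

lemma chi_shift:
  "chi0 (a + 3) = chi0 a + Delta0"
  "chi1 (a + 3) = chi1 a" "chi2 (a + 3) = chi2 a"
proof -
  have "X 1 - 1 dvd X a - 1"
  proof (cases "a \<ge> 0")
    case True
    then show ?thesis using X_diff_1_dvd[of 1 "nat a"] by simp
  next
    case False
    have "X a - 1 = - X a * (X (- a) - 1)"
      by (simp add: algebra_simps flip: X_add)
    then show ?thesis using False X_diff_1_dvd[of 1 "nat (- a)"] by simp
  qed
  then have "rel_untw dvd (X a - 1) * (X 3 - 1)"
    unfolding rel_untw_def by (rule mult_dvd_mono) simp
  then have "rel_untw dvd X (a + 3) - (X a + (X 3 - X 0))"
    by (simp add: algebra_simps X_add)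
  then show "chi0 (a + 3) = chi0 a + Delta0"
    unfolding Delta0_def by transfer simp
  have "rel_tw dvd X (a + 3) - X a"
    by (rule dvdI[of _ _ "X a"]) (simp add: rel_tw_def algebra_simps X_add)
  then show "chi1 (a + 3) = chi1 a" "chi2 (a + 3) = chi2 a"
    by (transfer; simp)+
qed

lemma int_induct_mod3:
  assumes "P 0" "P 1" "P 2" and step: "\<And>a :: int. P (a + 3) \<longleftrightarrow> P a"
  shows "P a"
proof -
  have "P (r + 3 * q)" if "P r" for q r :: int
  proof (induction q rule: int_induct[where k = 0])
    case base
    then show ?case using that by simp
  next
    case (step1 q)
    then show ?case using step[of "r + 3 * q"] by (simp add: algebra_simps)
  next
    case (step2 q)
    then show ?case using step[of "r + 3 * (q - 1)"] by (simp add: algebra_simps)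
  qed
  moreover have "a = a mod 3 + 3 * (a div 3)" by simp
  moreover have "P (a mod 3)"
  proof -
    have "a mod 3 = 0 \<or> a mod 3 = 1 \<or> a mod 3 = 2" by presburger
    then show ?thesis using assms(1-3) by metis
  qed
  ultimately show ?thesis by metis
qed

lemma span_eq_UNIV_if_chi:
  assumes "\<And>a. chi0 a \<in> KI.span S" "\<And>a. chi1 a \<in> KI.span S" "\<And>a. chi2 a \<in> KI.span S"
  shows "KI.span S = UNIV"
proof -
  have "x \<in> KI.span S" for x
  proof -
    obtain f0 f1 f2 where x: "x = abs_KI (f0, f1, f2)" by (rule KI_cases)
    have "abs_KI (f0, 0, 0) \<in> KI.span S"
    proof (induction f0 rule: laurent_induct)
      case (single a c)
      have "abs_KI (Poly_Mapping.single a c, 0, 0) = c *\<^sub>K chi0 a"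
        by (simp add: chi0.abs_eq scaleKI.abs_eq X_def const_def mult_single)
      then show ?case using assms by (simp add: KI.span_scale)
    next
      case (add f g)
      then show ?case using KI.span_add plus_KI.abs_eq by fastforce
    qed
    moreover have "abs_KI (0, f1, 0) \<in> KI.span S"
    proof (induction f1 rule: laurent_induct)
      case (single a c)
      have "abs_KI (0, Poly_Mapping.single a c, 0) = c *\<^sub>K chi1 a"
        by (simp add: chi1.abs_eq scaleKI.abs_eq X_def const_def mult_single)
      then show ?case using assms by (simp add: KI.span_scale)
    next
      case (add f g)
      then show ?case using KI.span_add plus_KI.abs_eq by fastforce
    qed
    moreover have "abs_KI (0, 0, f2) \<in> KI.span S"
    proof (induction f2 rule: laurent_induct)
      case (single a c)
      have "abs_KI (0, 0, Poly_Mapping.single a c) = c *\<^sub>K chi2 a"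
        by (simp add: chi2.abs_eq scaleKI.abs_eq X_def const_def mult_single)
      then show ?case using assms by (simp add: KI.span_scale)
    next
      case (add f g)
      then show ?case using KI.span_add plus_KI.abs_eq by fastforce
    qed
    moreover have "x = abs_KI (f0, 0, 0) + abs_KI (0, f1, 0) + abs_KI (0, 0, f2)"
      by (simp add: x plus_KI.abs_eq)
    ultimately show ?thesis by (simp add: KI.span_add)
  qed
  then show ?thesis by blast
qed

text \<open>The vectors \<open>\<Delta>\<^sub>0, \<Delta>\<^sub>1, \<Delta>\<^sub>2\<close> replace \<open>\<chi>\<^sub>0\<^sup>3, \<chi>\<^sub>1\<^sup>2, \<chi>\<^sub>2\<^sup>2\<close> in the monomial basis, so that \<open>J\<close> is spanned
by a part of this family.\<close>

definition KI_basis :: "KI set" where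
  "KI_basis = {chi0 0, chi0 1, chi0 2, chi1 0, chi1 1, chi2 0, chi2 1, Delta0, Delta1, Delta2}"

lemma span_KI_basis: "KI.span KI_basis = UNIV"
proof (rule span_eq_UNIV_if_chi)
  note base = KI.span_base[of _ KI_basis]
  have Delta: "Delta0 \<in> KI.span KI_basis" by (rule base) (simp add: KI_basis_def)
  have cancel: "x + y \<in> KI.span KI_basis \<longleftrightarrow> x \<in> KI.span KI_basis"
    if "y \<in> KI.span KI_basis" for x y
    using that by (metis KI.span_add KI.span_diff add_diff_cancel_right')
  have chi12: "chi1 2 = Delta1 - chi1 0 - chi1 1" by (simp add: Delta1_def)
  have chi22: "chi2 2 = Delta2 - chi2 0 - chi2 1" by (simp add: Delta2_def)
  fix a
  show "chi0 a \<in> KI.span KI_basis"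
    by (induction a rule: int_induct_mod3)
      (simp_all add: chi_shift cancel Delta, (rule base; simp add: KI_basis_def)+)
  show "chi1 a \<in> KI.span KI_basis"
    by (induction a rule: int_induct_mod3)
      (auto simp: chi_shift chi12 KI_basis_def intro!: KI.span_diff intro: KI.span_base)
  show "chi2 a \<in> KI.span KI_basis"
    by (induction a rule: int_induct_mod3)
      (auto simp: chi_shift chi22 KI_basis_def intro!: KI.span_diff intro: KI.span_base)
qed

lemma point_char_Delta [simp]:
  "point_char i t Delta0 = 0" "point_char i t Delta1 = 0" "point_char i t Delta2 = 0"
proof -
  define w where "w = zeta3 ^ i"
  have w3: "w ^ 3 = 1" by (simp add: w_def)
  have "(1 - w ^ 2) * (1 + w + w ^ 2) = 0"
    using w3 by algebra
  then have *: "(1 - zeta3 ^ (2 * i)) * (1 + zeta3 ^ i + (zeta3 ^ i)\<^sup>2) = 0"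
    by (simp add: w_def power_mult mult.commute)
  have **: "c * (1 - zeta3 ^ (2 * i)) + c * (1 - zeta3 ^ (2 * i)) * zeta3 ^ i
      + c * (1 - zeta3 ^ (2 * i)) * (zeta3 ^ i)\<^sup>2 = 0" for c
    using arg_cong[OF *, of "\<lambda>x. c * x"]
    by (simp only: distrib_left mult.assoc mult_1_right mult_zero_right)
  show "point_char i t Delta0 = 0"
    by (simp add: Delta0_def power_int_def)
  show "point_char i t Delta1 = 0" "point_char i t Delta2 = 0"
    using ** by (simp_all add: Delta1_def Delta2_def power_int_def)
qed

lemma tangent_chi [simp]:
  "tangent m (chi0 a) = (if m = 0 then of_int a else 0)"
  "tangent m (chi1 a) = (if m = 1 then 1 else 0)"
  "tangent m (chi2 a) = (if m = 0 \<or> m = 1 then 0 else 1)"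
  by (transfer; simp)+

lemma point_char_zero_if_mem_J: "v \<in> J \<Longrightarrow> point_char i t v = 0"
  unfolding J_def by (induction rule: KI.span_induct_alt) auto

text \<open>Modulo \<open>J\<close> the element is a combination \<open>y\<close> of the seven remaining spanning vectors.  Its value at
\<open>(w, s)\<close> is a quadratic polynomial in \<open>s\<close>, whose three coefficients must vanish; each of them
reduces modulo \<open>w\<^sup>3 = 1\<close> to a quadratic polynomial in \<open>w\<close>, whose coefficients vanish in turn.\<close>

lemma mem_J_if_point_char_zero:
  assumes "\<And>i t. point_char i t x = 0"
  shows "x \<in> J"
proof -
  have "x \<in> KI.span KI_basis" by (simp add: span_KI_basis)
  then obtain a0 a1 a2 b0 b1 c0 c1 where "x - a0 *\<^sub>K chi0 0 - a1 *\<^sub>K chi0 1 - a2 *\<^sub>K chi0 2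
      - b0 *\<^sub>K chi1 0 - b1 *\<^sub>K chi1 1 - c0 *\<^sub>K chi2 0 - c1 *\<^sub>K chi2 1 \<in> J"
    unfolding KI_basis_def J_def KI.span_insert[of "chi0 _"] KI.span_insert[of "chi1 _"]
      KI.span_insert[of "chi2 _"] by blast
  moreover define y where "y = a0 *\<^sub>K chi0 0 + a1 *\<^sub>K chi0 1 + a2 *\<^sub>K chi0 2
      + b0 *\<^sub>K chi1 0 + b1 *\<^sub>K chi1 1 + c0 *\<^sub>K chi2 0 + c1 *\<^sub>K chi2 1"
  ultimately have "x - y \<in> J" by (simp add: algebra_simps)
  have y: "point_char i t y = 0" for i t
    using point_char_zero_if_mem_J[OF \<open>x - y \<in> J\<close>, of i t] assms[of i t] by simp
  have e: "(a0 + a1 * zeta3 ^ i + a2 * zeta3 ^ (2 * i))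
      + ((1 - zeta3 ^ (2 * i)) * (b0 + b1 * zeta3 ^ i)) * zeta3 ^ t
      + ((1 - zeta3 ^ (2 * i)) * (c0 + c1 * zeta3 ^ i)) * zeta3 ^ (2 * t) = 0" for i t
    using y[of i t] by (simp add: y_def power_int_def algebra_simps power_mult)
  note z = zeta3_quadratic_zero[OF e]
  have exp: "(1 - zeta3 ^ (2 * i)) * (b + b' * zeta3 ^ i)
      = (b - b') + b' * zeta3 ^ i + (- b) * zeta3 ^ (2 * i)" for b b' i
  proof -
    define w where "w = zeta3 ^ i"
    have w3: "w * w * w = 1" using zeta3_power_cubed[of i] by (simp add: w_def power3_eq_cube)
    have "(1 - w * w) * (b + b' * w) = b + b' * w - b * (w * w) - b' * (w * w * w)"
      by (simp add: algebra_simps)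
    then show ?thesis by (simp add: w3 flip: w_def) (simp add: w_def mult_2 power_add)
  qed
  have "a0 = 0" "a1 = 0" "a2 = 0"
    using zeta3_quadratic_zero[OF z(1)] by auto
  moreover have "b0 = 0" "b1 = 0"
    using zeta3_quadratic_zero[OF z(2)[unfolded exp]] by auto
  moreover have "c0 = 0" "c1 = 0"
    using zeta3_quadratic_zero[OF z(3)[unfolded exp]] by auto
  ultimately have "y = 0" by (simp add: y_def)
  then show ?thesis using \<open>x - y \<in> J\<close> by simp
qed

lemma mem_J_iff: "x \<in> J \<longleftrightarrow> (\<forall>i t. point_char i t x = 0)"
  using mem_J_if_point_char_zero point_char_zero_if_mem_J by blast

text \<open>The difference lies in \<open>J\<close>, where the three tangent functionals are, up to a factor \<open>3\<close>, the coordinates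
with respect to \<open>\<Delta>\<^sub>0, \<Delta>\<^sub>1, \<Delta>\<^sub>2\<close>.\<close>

lemma KI_eqI:
  assumes "\<And>i t. point_char i t x = point_char i t y" "\<And>m. tangent m x = tangent m y"
  shows "x = y"
proof -
  have "x - y \<in> J" using assms by (simp add: mem_J_iff)
  then obtain d0 d1 d2 where "x - y - d0 *\<^sub>K Delta0 - d1 *\<^sub>K Delta1 - d2 *\<^sub>K Delta2 = 0"
    unfolding J_def KI.span_insert by auto
  then have d: "x - y = d0 *\<^sub>K Delta0 + d1 *\<^sub>K Delta1 + d2 *\<^sub>K Delta2"
    by (simp add: algebra_simps)
  have "tangent m (x - y) = 0" for m using assms by simp
  from this[of 0] this[of 1] this[of 2] have "d0 = 0" "d1 = 0" "d2 = 0"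
    by (simp_all add: d Delta0_def Delta1_def Delta2_def)
  then show ?thesis using d by simp
qed

section \<open>Lambda-line elements in terms of characters\<close>

text \<open>The hypothesis is the description of \<open>\<lambda>\<close>-line elements in \<open>P1_iff\<close>, kept as an assumption because
the inverse is needed to prove that description.  Over \<open>w\<close> the product has value \<open>y\<^sup>i y\<^sup>2\<^sup>i = y\<^sup>3\<^sup>i\<close> with \<open>y\<close> the value
over \<open>\<zeta>\<close>, and \<open>y\<^sup>3\<^sup>i\<close> is the value over \<open>\<zeta>\<^sup>3\<^sup>i = 1\<close>; the tangent coordinates of \<open>L\<close> and its dual cancel.\<close>

lemma mult_dagger_eq_1:
  assumes pow: "\<forall>t r. point_char r t L = point_char 1 t L ^ r"
  shows "L * dagger L = 1"
proof (rule KI_eqI)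
  have 0: "point_char 0 t L = 1" for t using pow[rule_format, of 0 t] by simp
  show "point_char i t (L * dagger L) = point_char i t 1" for i t
  proof -
    have "point_char i t L * point_char (2 * i) t L = point_char 1 t L ^ i * point_char 1 t L ^ (2 * i)"
      by (simp only: pow[rule_format, of i t] pow[rule_format, of "2 * i" t])
    also have "\<dots> = point_char 1 t L ^ (3 * i)" by (simp only: power_add[symmetric]) simp
    also have "\<dots> = point_char (3 * i) t L" by (rule pow[rule_format, symmetric])
    also have "\<dots> = point_char 0 t L"
      by (rule point_char_cong) (simp add: power_mult zeta3_cubed)
    finally show ?thesis by (simp add: 0)
  qed
  show "tangent m (L * dagger L) = tangent m 1" for m
    by (simp add: tangent_mult 0)
qed

text \<open>Evaluating \<open>\<psi>\<^sup>r(L) = L\<^sup>r\<close> at the points gives the power condition for \<open>r \<ge> 1\<close>.  The case \<open>r = 0\<close> says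
that the value \<open>c\<close> over \<open>w = 1\<close> is \<open>1\<close>: it satisfies \<open>c = c\<^sup>2\<close> and is a unit since \<open>L\<close> is invertible.
Conversely the power condition gives \<open>\<psi>\<^sup>r(L) = L\<^sup>r\<close> on points, and on tangent coordinates both
sides are multiplied by \<open>r\<close>.\<close>

lemma P1_iff: "L \<in> P1 \<longleftrightarrow> (\<forall>t r. point_char r t L = point_char 1 t L ^ r)"
proof
  assume "L \<in> P1"
  then obtain M where M: "L * M = 1" and psi: "\<And>r. r > 0 \<Longrightarrow> psi r L = L ^ r"
    by (auto simp: P1_def lambda_line_def lambda_t_eq_iff)
  have pow: "point_char (r * i) t L = point_char i t L ^ r" if "r > 0" for r i t
    using arg_cong[OF psi[OF that], of "point_char i t"] by simp
  have "point_char 0 t L = 1" for t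
  proof -
    have "point_char 0 t L * point_char 0 t M = 1"
      using arg_cong[OF M, of "point_char 0 t"] by simp
    moreover have "point_char 0 t L = point_char 0 t L * point_char 0 t L"
      using pow[of 2 0 t] by (simp add: power2_eq_square)
    ultimately show ?thesis by (metis mult.assoc mult.right_neutral)
  qed
  then have "point_char r t L = point_char 1 t L ^ r" for r t
    using pow[of r 1 t] by (cases "r = 0") (simp_all only: mult_1_right power_0 neq0_conv)
  then show "\<forall>t r. point_char r t L = point_char 1 t L ^ r" by blast
next
  assume pow: "\<forall>t r. point_char r t L = point_char 1 t L ^ r"
  have 0: "point_char 0 t L = 1" for t using pow[rule_format, of 0 t] by simp
  have mult: "point_char (r * i) t L = point_char i t L ^ r" for r i t
  proof -
    have "point_char (r * i) t L = point_char 1 t L ^ (r * i)" by (rule pow[rule_format])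
    also have "\<dots> = (point_char 1 t L ^ i) ^ r" by (simp only: mult.commute[of r] power_mult)
    also have "\<dots> = point_char i t L ^ r" by (simp only: pow[rule_format, of i t])
    finally show ?thesis .
  qed
  have "L * dagger L = 1" using pow by (rule mult_dagger_eq_1)
  then have "\<exists>M. L * M = 1" by (rule exI)
  moreover have "psi r L = L ^ r" for r
  proof (rule KI_eqI)
    show "point_char i t (psi r L) = point_char i t (L ^ r)" for i t
      unfolding point_char_psi point_char_power by (rule mult)
    show "tangent m (psi r L) = tangent m (L ^ r)" for m
      unfolding tangent_psi tangent_power[OF 0] by (rule refl)
  qed
  ultimately show "L \<in> P1"
    unfolding P1_def lambda_line_def lambda_t_eq_iff by (intro CollectI conjI allI impI)
qed

lemma P1_power: "L \<in> P1 \<Longrightarrow> point_char r t L = point_char 1 t L ^ r"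
  by (rule P1_iff[THEN iffD1, rule_format])

lemma dagger_mem_P1:
  assumes "L \<in> P1" shows "dagger L \<in> P1"
  unfolding P1_iff point_char_dagger
proof (intro allI)
  fix t r
  note pow = P1_power[OF assms, of _ t]
  show "point_char (2 * r) t L = point_char (2 * 1) t L ^ r"
    unfolding pow[of "2 * r"] pow[of "2 * 1"] by (simp add: power_mult)
qed

lemma J_translate_mem_P1:
  assumes "v \<in> J" "L \<in> P1" shows "v + L \<in> P1"
proof -
  have "point_char i t (v + L) = point_char i t L" for i t
    using assms(1) by (simp add: mem_J_iff)
  then show ?thesis using P1_power[OF assms(2)] unfolding P1_iff by metis
qed
lemma mem_J_orbit_iff: "R \<in> J_orbit L \<longleftrightarrow> R - L \<in> J"
proof
  assume "R - L \<in> J"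
  then have "(R - L) + L \<in> J_orbit L" unfolding J_orbit_def by blast
  then show "R \<in> J_orbit L" by simp
qed (auto simp: J_orbit_def)

lemma J_orbit_eq_iff:
  "J_orbit L = J_orbit L' \<longleftrightarrow> L - L' \<in> J"
proof -
  have self: "L \<in> J_orbit L" by (simp add: mem_J_orbit_iff mem_J_iff)
  show ?thesis
  proof
    assume "J_orbit L = J_orbit L'"
    with self have "L \<in> J_orbit L'" by simp
    then show "L - L' \<in> J" by (simp only: mem_J_orbit_iff)
  next
    assume "L - L' \<in> J"
    then have eq: "point_char i t L = point_char i t L'" for i t by (simp add: mem_J_iff)
    show "J_orbit L = J_orbit L'"
      by (rule set_eqI) (simp add: mem_J_orbit_iff mem_J_iff eq)
  qed
qed

lemma point_char_t_mod: "point_char i (t mod 3) x = point_char i t x"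
proof -
  have "zeta3 ^ (2 * (t mod 3)) = zeta3 ^ (2 * t)"
    unfolding mult.commute[of 2] power_mult zeta3_power_mod by (rule refl)
  then show ?thesis by transfer (simp add: zeta3_power_mod)
qed

text \<open>Exponents of \<open>\<zeta>\<close> count modulo three, so only the points over \<open>1\<close>, \<open>\<zeta>\<close> and \<open>\<zeta>\<^sup>2\<close> need to be checked.\<close>

lemma mem_P1I:
  assumes 0: "point_char 0 0 L = 1"
    and 12: "\<And>t. \<exists>n. point_char 1 t L = zeta3 ^ n \<and> point_char 2 t L = zeta3 ^ (2 * n)"
  shows "L \<in> P1"
  unfolding P1_iff
proof (intro allI)
  fix t r :: nat
  obtain n where n: "point_char 1 t L = zeta3 ^ n" "point_char 2 t L = zeta3 ^ (2 * n)"
    using 12 by blast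
  have "point_char 0 t L = 1" using 0 by transfer auto
  moreover have "r mod 3 = 0 \<or> r mod 3 = 1 \<or> r mod 3 = 2" by linarith
  ultimately have "point_char (r mod 3) t L = zeta3 ^ (n * (r mod 3))"
    using n by (elim disjE)
      (simp_all only: mult_0_right mult_1_right power_0 mult.commute[of n 2])
  then have *: "point_char (r mod 3) t L = (zeta3 ^ (r mod 3)) ^ n"
    by (simp add: mult.commute flip: power_mult)
  have "point_char r t L = point_char (r mod 3) t L"
    by (rule point_char_cong) (simp add: zeta3_power_mod)
  also have "\<dots> = (zeta3 ^ r) ^ n" unfolding * zeta3_power_mod by (rule refl)
  also have "\<dots> = point_char 1 t L ^ r"
    by (simp only: n mult.commute[of r] flip: power_mult)
  finally show "point_char r t L = point_char 1 t L ^ r" .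
qed

section \<open>Values of the orbit representatives\<close>

lemma point_char_Sigma_rep:
  assumes "i \<ge> 1"
  shows "point_char r t (Sigma_rep i) = zeta3 ^ (r * (i - 1))"
proof -
  have "int i - 1 = int (i - 1)" using assms by simp
  then show ?thesis by (simp add: Sigma_rep_def power_mult del: of_nat_diff)
qed

lemma point_char_1_basis:
  "point_char 1 t (chi0 0) = 1" "point_char 1 t (chi0 1) = zeta3"
  "point_char 1 t (chi0 2) = - 1 - zeta3"
  "point_char 1 t (chi1 0) = (2 + zeta3) * zeta3 ^ t"
  "point_char 1 t (chi1 1) = (zeta3 - 1) * zeta3 ^ t"
  "point_char 1 t (chi2 0) = (2 + zeta3) * zeta3 ^ (2 * t)"
  "point_char 1 t (chi2 1) = (zeta3 - 1) * zeta3 ^ (2 * t)"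
  by (simp_all add: zeta3_numeral_power algebra_simps zeta3_square)

lemma point_char_2_basis:
  "point_char 2 t (chi0 0) = 1" "point_char 2 t (chi0 1) = - 1 - zeta3"
  "point_char 2 t (chi0 2) = zeta3"
  "point_char 2 t (chi1 0) = (1 - zeta3) * zeta3 ^ t"
  "point_char 2 t (chi1 1) = (- 2 - zeta3) * zeta3 ^ t"
  "point_char 2 t (chi2 0) = (1 - zeta3) * zeta3 ^ (2 * t)"
  "point_char 2 t (chi2 1) = (- 2 - zeta3) * zeta3 ^ (2 * t)"
  by (simp_all add: zeta3_numeral_power algebra_simps zeta3_square power2_eq_square)

lemmas point_char_linear = point_char_simps(3-6)

lemma third: "(1/3) * x = (y :: complex) \<longleftrightarrow> x = 3 * y" by (auto simp: field_simps)

lemma D_rep_simps: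
  "D_rep 1 j = (1/3) *\<^sub>K (chi0 0 + chi0 1 + chi0 2
     - zeta3^j *\<^sub>K chi1 0 + chi1 1 - zeta3^(2*j) *\<^sub>K chi2 0 + chi2 1)"
  "D_rep 2 j = (1/3) *\<^sub>K (chi0 0 + chi0 1 + chi0 2
     - chi1 0 + zeta3^j *\<^sub>K chi1 1 - chi2 0 + zeta3^(2*j) *\<^sub>K chi2 1)"
  "D_rep 3 j = (1/3) *\<^sub>K (chi0 0 + chi0 1 + chi0 2
     - zeta3^(2*j) *\<^sub>K chi1 0 + zeta3^j *\<^sub>K chi1 1
     - zeta3^j *\<^sub>K chi2 0 + zeta3^(2*j) *\<^sub>K chi2 1)"
  by (simp_all add: D_rep_def)

lemma T_rep_simps:
  "T_rep 1 k = (1/3) *\<^sub>K (chi0 0 + 2 *\<^sub>K chi0 2 + zeta3^k *\<^sub>K chi1 0 + zeta3^(2*k) *\<^sub>K chi2 0)"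
  "T_rep 2 k = (1/3) *\<^sub>K (2 *\<^sub>K chi0 0 + chi0 2 - zeta3^k *\<^sub>K chi1 0 - zeta3^(2*k) *\<^sub>K chi2 0)"
  "T_rep 3 k = (1/3) *\<^sub>K (2 *\<^sub>K chi0 0 + chi0 1 + zeta3^k *\<^sub>K chi1 1 + zeta3^(2*k) *\<^sub>K chi2 1)"
  "T_rep 4 k = (1/3) *\<^sub>K (chi0 0 + 2 *\<^sub>K chi0 1 - zeta3^k *\<^sub>K chi1 1 - zeta3^(2*k) *\<^sub>K chi2 1)"
  "T_rep 5 k = (1/3) *\<^sub>K (chi0 1 + 2 *\<^sub>K chi0 2 + zeta3^k *\<^sub>K chi1 0 + zeta3^k *\<^sub>K chi1 1
         + zeta3^(2*k) *\<^sub>K chi2 0 + zeta3^(2*k) *\<^sub>K chi2 1)"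
  "T_rep 6 k = (1/3) *\<^sub>K (2 *\<^sub>K chi0 1 + chi0 2 - zeta3^k *\<^sub>K chi1 0 - zeta3^k *\<^sub>K chi1 1
         - zeta3^(2*k) *\<^sub>K chi2 0 - zeta3^(2*k) *\<^sub>K chi2 1)"
  by (simp_all add: T_rep_def)

lemma D_powers:
  "zeta3 ^ 1 = zeta3" "zeta3 ^ (2 * 1) = - 1 - zeta3"
  "zeta3 ^ 2 = - 1 - zeta3" "zeta3 ^ (2 * 2) = zeta3"
  using zeta3_numeral_power by simp_all

text \<open>In each \<open>D_rep i j\<close> the untwisted part contributes \<open>1 + \<zeta> + \<zeta>\<^sup>2 = 0\<close>, and one of the two twisted parts
vanishes as well, which leaves a single monomial in \<open>s\<close>.\<close>

lemma point_char_1_D_rep_values: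
  "point_char 1 t (D_rep 1 1) = zeta3 * zeta3 ^ (2 * t)"
  "point_char 1 t (D_rep 1 2) = zeta3 * zeta3 ^ t"
  "point_char 1 t (D_rep 2 1) = (- 1 - zeta3) * zeta3 ^ t"
  "point_char 1 t (D_rep 2 2) = (- 1 - zeta3) * zeta3 ^ (2 * t)"
  "point_char 1 t (D_rep 3 1) = zeta3 ^ (2 * t)"
  "point_char 1 t (D_rep 3 2) = zeta3 ^ t"
  by (simp_all only: D_rep_simps point_char_linear point_char_1_basis third D_powers)
    (simp_all add: algebra_simps zeta3_square)

lemma point_char_2_D_rep_values:
  "point_char 2 t (D_rep 1 1) = (- 1 - zeta3) * zeta3 ^ t"
  "point_char 2 t (D_rep 1 2) = (- 1 - zeta3) * zeta3 ^ (2 * t)"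
  "point_char 2 t (D_rep 2 1) = zeta3 * zeta3 ^ (2 * t)"
  "point_char 2 t (D_rep 2 2) = zeta3 * zeta3 ^ t"
  "point_char 2 t (D_rep 3 1) = zeta3 ^ t"
  "point_char 2 t (D_rep 3 2) = zeta3 ^ (2 * t)"
  by (simp_all only: D_rep_simps point_char_linear point_char_2_basis third D_powers)
    (simp_all add: algebra_simps zeta3_square)

text \<open>The values of the third family at points over \<open>\<zeta>\<close> and \<open>\<zeta>\<^sup>2\<close> depend on \<open>t\<close> and \<open>k\<close> only through the sum of
\<open>\<zeta>\<^sup>t\<^sup>+\<^sup>k\<close> and its square.  That this sum takes only two values, one of them for a single \<open>t\<close>
modulo \<open>3\<close>, is why two of the three entries of the triple coincide.\<close>

definition T_sum :: "nat \<Rightarrow> complex" where "T_sum n = zeta3 ^ n + zeta3 ^ (2 * n)"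

lemma T_sum: "T_sum n = (if 3 dvd n then 2 else - 1)"
proof -
  have n: "zeta3 ^ n = zeta3 ^ (n mod 3)" by (simp only: zeta3_power_mod)
  have sq: "zeta3 ^ (2 * n) = zeta3 ^ n * zeta3 ^ n" by (simp add: mult_2 power_add)
  have "n mod 3 = 0 \<or> n mod 3 = 1 \<or> n mod 3 = 2" by linarith
  then show ?thesis
    unfolding T_sum_def sq dvd_eq_mod_eq_0 n
    by (elim disjE) (simp_all add: zeta3_numeral_power zeta3_square algebra_simps)
qed

lemma T_sum_fold:
  "zeta3 ^ k * (a * zeta3 ^ t) = a * zeta3 ^ (t + k)"
  "zeta3 ^ (2 * k) * (a * zeta3 ^ (2 * t)) = a * zeta3 ^ (2 * (t + k))"
  by (simp_all add: power_add algebra_simps)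

lemma point_char_1_T_rep_values:
  "point_char 1 t (T_rep 1 k) = (1/3) * (- 1 - 2 * zeta3 + (2 + zeta3) * T_sum (t + k))"
  "point_char 1 t (T_rep 2 k) = (1/3) * (1 - zeta3 - (2 + zeta3) * T_sum (t + k))"
  "point_char 1 t (T_rep 3 k) = (1/3) * (2 + zeta3 + (zeta3 - 1) * T_sum (t + k))"
  "point_char 1 t (T_rep 4 k) = (1/3) * (1 + 2 * zeta3 - (zeta3 - 1) * T_sum (t + k))"
  "point_char 1 t (T_rep 5 k) = (1/3) * (- 2 - zeta3 + (1 + 2 * zeta3) * T_sum (t + k))"
  "point_char 1 t (T_rep 6 k) = (1/3) * (zeta3 - 1 - (1 + 2 * zeta3) * T_sum (t + k))"
  unfolding T_rep_simps point_char_linear point_char_1_basis T_sum_fold T_sum_def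
  by (simp_all add: algebra_simps)

lemma point_char_2_T_rep_values:
  "point_char 2 t (T_rep 1 k) = (1/3) * (1 + 2 * zeta3 + (1 - zeta3) * T_sum (t + k))"
  "point_char 2 t (T_rep 2 k) = (1/3) * (2 + zeta3 - (1 - zeta3) * T_sum (t + k))"
  "point_char 2 t (T_rep 3 k) = (1/3) * (1 - zeta3 - (2 + zeta3) * T_sum (t + k))"
  "point_char 2 t (T_rep 4 k) = (1/3) * (- 1 - 2 * zeta3 + (2 + zeta3) * T_sum (t + k))"
  "point_char 2 t (T_rep 5 k) = (1/3) * (zeta3 - 1 - (1 + 2 * zeta3) * T_sum (t + k))"
  "point_char 2 t (T_rep 6 k) = (1/3) * (- 2 - zeta3 + (1 + 2 * zeta3) * T_sum (t + k))"
  unfolding T_rep_simps point_char_linear point_char_2_basis T_sum_fold T_sum_def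
  by (simp_all add: algebra_simps)

lemma point_char_D_rep:
  assumes "i \<in> {1..3}" "j \<in> {1..2}"
  shows "point_char 1 t (D_rep i j) = zeta3 ^ (i + (if i = 2 then j else 3 - j) * t)"
    "point_char 2 t (D_rep i j) = zeta3 ^ (2 * (i + (if i = 2 then j else 3 - j) * t))"
proof -
  have i: "i = 1 \<or> i = 2 \<or> i = 3" and j: "j = 1 \<or> j = 2"
    using assms by auto
  have four: "zeta3 ^ (4 * t) = zeta3 ^ t"
    by (rule zeta3_power_cong) presburger
  show "point_char 1 t (D_rep i j) = zeta3 ^ (i + (if i = 2 then j else 3 - j) * t)"
    using i j by (elim disjE)
      (simp_all only: point_char_1_D_rep_values power_add, simp_all add: zeta3_numeral_power)
  show "point_char 2 t (D_rep i j) = zeta3 ^ (2 * (i + (if i = 2 then j else 3 - j) * t))"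
    using i j by (elim disjE)
      (simp_all only: point_char_2_D_rep_values power_add distrib_left,
        simp_all add: zeta3_numeral_power four)
qed

text \<open>The exponents of \<open>\<zeta>\<close> in the exceptional entry and in the two equal entries of the triple of
\<open>T_rep i k\<close>; the index \<open>i\<close> runs through the six ordered pairs of distinct exponents, while \<open>k\<close> decides which entry
is exceptional.\<close>

definition T_special :: "nat \<Rightarrow> nat" where "T_special i = [0, 2, 1, 0, 1, 2] ! (i - 1)"
definition T_generic :: "nat \<Rightarrow> nat" where "T_generic i = [2, 0, 0, 1, 2, 1] ! (i - 1)"

lemma point_char_T_rep:
  assumes "i \<in> {1..6}"
  shows "point_char 1 t (T_rep i k) = zeta3 ^ (if 3 dvd t + k then T_special i else T_generic i)"
    "point_char 2 t (T_rep i k) = zeta3 ^ (2 * (if 3 dvd t + k then T_special i else T_generic i))"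
proof -
  have i: "i = 1 \<or> i = 2 \<or> i = 3 \<or> i = 4 \<or> i = 5 \<or> i = 6" using assms by auto
  show "point_char 1 t (T_rep i k) = zeta3 ^ (if 3 dvd t + k then T_special i else T_generic i)"
    using i by (elim disjE) (simp_all only: point_char_1_T_rep_values T_sum third,
      auto simp: T_special_def T_generic_def zeta3_numeral_power zeta3_square algebra_simps)
  show "point_char 2 t (T_rep i k) = zeta3 ^ (2 * (if 3 dvd t + k then T_special i else T_generic i))"
    using i by (elim disjE) (simp_all only: point_char_2_T_rep_values T_sum third,
      auto simp: T_special_def T_generic_def zeta3_numeral_power zeta3_square algebra_simps)
qed

section \<open>The twenty-seven orbits\<close>

text \<open>The values at the three points over \<open>w = \<zeta>\<close>; by \<open>P1_iff\<close> they determine all others.\<close>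

definition signature :: "KI \<Rightarrow> complex \<times> complex \<times> complex" where
  "signature L = (point_char 1 0 L, point_char 1 1 L, point_char 1 2 L)"

lemma signature_mem_cube_roots:
  assumes "L \<in> P1"
  shows "signature L \<in> cube_roots \<times> cube_roots \<times> cube_roots"
proof -
  have "point_char 1 t L ^ 3 = 1" for t
  proof -
    have "point_char 1 t L ^ 3 = point_char 3 t L" by (rule P1_power[OF assms, symmetric])
    also have "\<dots> = point_char 0 t L"
      by (rule point_char_cong) (simp add: zeta3_cubed)
    also have "\<dots> = point_char 1 t L ^ 0" by (rule P1_power[OF assms])
    finally show ?thesis by simp
  qed
  then show ?thesis
    unfolding signature_def by (simp only: mem_Times_iff fst_conv snd_conv mem_cube_roots_iff)
qed

lemma same_J_orbit_iff:
  assumes "L \<in> P1" "L' \<in> P1"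
  shows "L - L' \<in> J \<longleftrightarrow> signature L = signature L'"
proof
  assume "L - L' \<in> J"
  then have "point_char i t L = point_char i t L'" for i t by (simp add: mem_J_iff)
  then show "signature L = signature L'" by (simp add: signature_def)
next
  assume eq: "signature L = signature L'"
  have 1: "point_char 1 t L = point_char 1 t L'" for t
  proof -
    have "t mod 3 = 0 \<or> t mod 3 = 1 \<or> t mod 3 = 2" by linarith
    then have "point_char 1 (t mod 3) L = point_char 1 (t mod 3) L'"
      using eq unfolding signature_def prod.inject by metis
    then show ?thesis by (simp only: point_char_t_mod)
  qed
  have "point_char i t L = point_char i t L'" for i t
  proof -
    have "point_char i t L = point_char 1 t L ^ i" by (rule P1_power[OF assms(1)])
    also have "\<dots> = point_char i t L'" unfolding 1 by (rule P1_power[OF assms(2), symmetric])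
    finally show ?thesis .
  qed
  then show "L - L' \<in> J" by (simp add: mem_J_iff)
qed

definition reps :: "KI set" where "reps = Sigma_reps \<union> D_reps \<union> T_reps"

lemma reps_subset_P1: "reps \<subseteq> P1"
proof -
  have "Sigma_rep i \<in> P1" if "i \<in> {1..3}" for i
  proof (rule mem_P1I)
    show "point_char 0 0 (Sigma_rep i) = 1"
      using that by (simp add: point_char_Sigma_rep)
    show "\<exists>n. point_char 1 t (Sigma_rep i) = zeta3 ^ n \<and> point_char 2 t (Sigma_rep i) = zeta3 ^ (2 * n)" for t
      using that by (intro exI[of _ "i - 1"]) (simp add: point_char_Sigma_rep)
  qed
  moreover have "D_rep i j \<in> P1" if "i \<in> {1..3}" "j \<in> {1..2}" for i j
  proof (rule mem_P1I)
    show "point_char 0 0 (D_rep i j) = 1"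
      by (simp add: D_rep_def)
    show "\<exists>n. point_char 1 t (D_rep i j) = zeta3 ^ n \<and> point_char 2 t (D_rep i j) = zeta3 ^ (2 * n)" for t
      using point_char_D_rep[OF that] by blast
  qed
  moreover have "T_rep i k \<in> P1" if "i \<in> {1..6}" for i k
  proof (rule mem_P1I)
    show "point_char 0 0 (T_rep i k) = 1"
      by (simp add: T_rep_def)
    show "\<exists>n. point_char 1 t (T_rep i k) = zeta3 ^ n \<and> point_char 2 t (T_rep i k) = zeta3 ^ (2 * n)" for t
      using point_char_T_rep[OF that] by blast
  qed
  ultimately show ?thesis
    unfolding reps_def Sigma_reps_def D_reps_def T_reps_def by auto
qed

lemma ex_T_index:
  fixes a b :: nat
  assumes "a < 3" "b < 3" "a \<noteq> b"
  obtains i where "i \<in> {1..6}" "T_special i = a" "T_generic i = b"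
proof -
  have "T_special 1 = 0" "T_generic 1 = 2" "T_special 2 = 2" "T_generic 2 = 0" "T_special 3 = 1" "T_generic 3 = 0"
    "T_special 4 = 0" "T_generic 4 = 1" "T_special 5 = 1" "T_generic 5 = 2" "T_special 6 = 2" "T_generic 6 = 1"
    by (simp_all add: T_special_def T_generic_def)
  moreover have "(a, b) \<in> {(0, 2), (2, 0), (1, 0), (0, 1), (1, 2), (2, 1)}"
    using assms by auto
  ultimately show ?thesis
    using that[of 1] that[of 2] that[of 3] that[of 4] that[of 5] that[of 6] by auto
qed

text \<open>A triple of distinct exponents modulo three is an arithmetic progression with start \<open>i\<close> and nonzero
difference; in the naming of the representatives the differences for \<open>i = 2\<close> are swapped.\<close>

lemma ex_D_index:
  fixes a b c :: nat
  assumes "a < 3" "b < 3" "c < 3" "a \<noteq> b" "a \<noteq> c" "b \<noteq> c"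
  obtains i j where "i \<in> {1..3}" "j \<in> {1..2}" "i mod 3 = a"
    "(i + (if i = 2 then j else 3 - j)) mod 3 = b" "(i + (if i = 2 then j else 3 - j) * 2) mod 3 = c"
proof -
  have "a = 0 \<or> a = 1 \<or> a = 2" "b = 0 \<or> b = 1 \<or> b = 2" "c = 0 \<or> c = 1 \<or> c = 2"
    using assms(1-3) by linarith+
  then consider "a = 0" "b = 1" "c = 2"
    | "a = 0" "b = 2" "c = 1"
    | "a = 1" "b = 0" "c = 2"
    | "a = 1" "b = 2" "c = 0"
    | "a = 2" "b = 0" "c = 1"
    | "a = 2" "b = 1" "c = 0"
    using assms(4-6) by metis
  then show ?thesis
  proof cases
    case 1
    then show ?thesis by (intro that[of 3 2]) simp_all
  next
    case 2
    then show ?thesis by (intro that[of 3 1]) simp_all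
  next
    case 3
    then show ?thesis by (intro that[of 1 1]) simp_all
  next
    case 4
    then show ?thesis by (intro that[of 1 2]) simp_all
  next
    case 5
    then show ?thesis by (intro that[of 2 1]) simp_all
  next
    case 6
    then show ?thesis by (intro that[of 2 2]) simp_all
  qed
qed

lemma ex_rep:
  assumes "a < 3" "b < 3" "c < 3"
  shows "\<exists>R\<in>reps. signature R = (zeta3 ^ a, zeta3 ^ b, zeta3 ^ c)"
proof -
  have T: ?thesis if T: "i \<in> {1..6}" "k \<in> {0..2}"
      "(if 3 dvd 0 + k then T_special i else T_generic i) = a"
      "(if 3 dvd 1 + k then T_special i else T_generic i) = b"
      "(if 3 dvd 2 + k then T_special i else T_generic i) = c" for i k :: nat
  proof (rule bexI)
    show "signature (T_rep i k) = (zeta3 ^ a, zeta3 ^ b, zeta3 ^ c)"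
      unfolding signature_def point_char_T_rep[OF T(1)] T(3-5) by (rule refl)
    show "T_rep i k \<in> reps" using T(1,2) by (force simp: reps_def T_reps_def)
  qed
  \<comment> \<open>The exceptional entry of \<open>T_rep i k\<close> is at the position \<open>t\<close> with \<open>t + k \<equiv> 0\<close> modulo \<open>3\<close>.\<close>
  have dvd: "3 dvd (0 + 0 :: nat)" "\<not> 3 dvd (1 + 0 :: nat)" "\<not> 3 dvd (2 + 0 :: nat)"
    "\<not> 3 dvd (0 + 2 :: nat)" "3 dvd (1 + 2 :: nat)" "\<not> 3 dvd (2 + 2 :: nat)"
    "\<not> 3 dvd (0 + 1 :: nat)" "\<not> 3 dvd (1 + 1 :: nat)" "3 dvd (2 + 1 :: nat)"
    by presburger+
  consider "a = b" "a = c" | "a \<noteq> b" "b = c" | "b \<noteq> a" "a = c" | "c \<noteq> a" "a = b"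
    | "a \<noteq> b" "a \<noteq> c" "b \<noteq> c" by blast
  then show ?thesis
  proof cases
    case 1
    then have "signature (Sigma_rep (a + 1)) = (zeta3 ^ a, zeta3 ^ b, zeta3 ^ c)"
      by (simp add: signature_def point_char_Sigma_rep)
    moreover have "Sigma_rep (a + 1) \<in> reps"
      using assms by (auto simp: reps_def Sigma_reps_def)
    ultimately show ?thesis by blast
  next
    case 2
    obtain i where "i \<in> {1..6}" "T_special i = a" "T_generic i = b"
      using ex_T_index assms 2 by blast
    then show ?thesis
      using 2 by (intro T[of i 0]) (simp_all only: dvd if_True if_False, simp_all)
  next
    case 3
    obtain i where "i \<in> {1..6}" "T_special i = b" "T_generic i = a"
      using ex_T_index assms 3 by blast
    then show ?thesis
      using 3 by (intro T[of i 2]) (simp_all only: dvd if_True if_False, simp_all)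
  next
    case 4
    obtain i where "i \<in> {1..6}" "T_special i = c" "T_generic i = a"
      using ex_T_index assms 4 by blast
    then show ?thesis
      using 4 by (intro T[of i 1]) (simp_all only: dvd if_True if_False, simp_all)
  next
    case 5
    obtain i j where ij: "i \<in> {1..3}" "j \<in> {1..2}" and exponents: "i mod 3 = a"
      "(i + (if i = 2 then j else 3 - j)) mod 3 = b"
      "(i + (if i = 2 then j else 3 - j) * 2) mod 3 = c"
      by (rule ex_D_index[OF assms 5])
    have "signature (D_rep i j) = (zeta3 ^ a, zeta3 ^ b, zeta3 ^ c)"
      unfolding signature_def point_char_D_rep(1)[OF ij] mult_0_right mult_1_right add_0_right
      using zeta3_power_mod[of i, unfolded exponents(1)]
        zeta3_power_mod[of "i + (if i = 2 then j else 3 - j)", unfolded exponents(2)]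
        zeta3_power_mod[of "i + (if i = 2 then j else 3 - j) * 2", unfolded exponents(3)]
      by (simp only:)
    moreover have "D_rep i j \<in> reps" using ij by (force simp: reps_def D_reps_def)
    ultimately show ?thesis by blast
  qed
qed

lemma signature_reps: "signature ` reps = cube_roots \<times> cube_roots \<times> cube_roots"
proof
  show "signature ` reps \<subseteq> cube_roots \<times> cube_roots \<times> cube_roots"
    using signature_mem_cube_roots reps_subset_P1 by blast
  have exponent: "\<exists>a<3. z = zeta3 ^ a" if "z \<in> cube_roots" for z
    using that exI[of "\<lambda>a. a < 3 \<and> z = zeta3 ^ a" 0] exI[of "\<lambda>a. a < 3 \<and> z = zeta3 ^ a" 1]
      exI[of "\<lambda>a. a < 3 \<and> z = zeta3 ^ a" 2] by (auto simp: cube_roots_def)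
  show "cube_roots \<times> cube_roots \<times> cube_roots \<subseteq> signature ` reps"
  proof clarify
    fix x y z assume "x \<in> cube_roots" "y \<in> cube_roots" "z \<in> cube_roots"
    then obtain a b c where abc: "a < 3" "b < 3" "c < 3"
      and "x = zeta3 ^ a" "y = zeta3 ^ b" "z = zeta3 ^ c"
      using exponent by metis
    then show "(x, y, z) \<in> signature ` reps" using ex_rep[OF abc] by force
  qed
qed

text \<open>The families have at most \<open>3\<close>, \<open>6\<close> and \<open>18\<close> members but must supply \<open>27\<close> signatures, so all these bounds
are attained and there is no overlap.\<close>

lemma card_reps:
  "card Sigma_reps = 3" "card D_reps = 6" "card T_reps = 18" "card reps = 27"
  "Sigma_reps \<inter> D_reps = {}" "Sigma_reps \<inter> T_reps = {}" "D_reps \<inter> T_reps = {}"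
proof -
  have fin: "finite Sigma_reps" "finite D_reps" "finite T_reps"
    by (simp_all add: Sigma_reps_def D_reps_def T_reps_def)
  have S: "card Sigma_reps \<le> 3"
    unfolding Sigma_reps_def using card_image_le[of "{1..3::nat}" Sigma_rep] by simp
  have D: "card D_reps \<le> 6"
    unfolding D_reps_def
    using card_image_le[of "{1..3::nat} \<times> {1..2::nat}" "\<lambda>(i, j). D_rep i j"] by simp
  have T: "card T_reps \<le> 18"
    unfolding T_reps_def
    using card_image_le[of "{1..6::nat} \<times> {0..2::nat}" "\<lambda>(i, k). T_rep i k"] by simp
  have "27 = card (signature ` reps)"
    by (simp add: signature_reps card_cartesian_product card_cube_roots)
  also have "\<dots> \<le> card reps"
    by (rule card_image_le) (simp add: reps_def fin)
  finally have R: "27 \<le> card reps" .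
  have SD: "card Sigma_reps + card D_reps = card (Sigma_reps \<union> D_reps) + card (Sigma_reps \<inter> D_reps)"
    by (rule card_Un_Int) (simp_all add: fin)
  have SDT: "card (Sigma_reps \<union> D_reps) + card T_reps
      = card reps + card ((Sigma_reps \<union> D_reps) \<inter> T_reps)"
    unfolding reps_def by (rule card_Un_Int) (simp_all add: fin)
  show "card Sigma_reps = 3" "card D_reps = 6" "card T_reps = 18" "card reps = 27"
    using S D T R SD SDT by linarith+
  have "card (Sigma_reps \<inter> D_reps) = 0" "card ((Sigma_reps \<union> D_reps) \<inter> T_reps) = 0"
    using S D T R SD SDT by linarith+
  then show "Sigma_reps \<inter> D_reps = {}" "Sigma_reps \<inter> T_reps = {}" "D_reps \<inter> T_reps = {}"
    using fin by auto
qed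

lemma inj_on_signature: "inj_on signature reps"
proof (rule eq_card_imp_inj_on)
  show "finite reps" by (simp add: reps_def Sigma_reps_def D_reps_def T_reps_def)
  show "card (signature ` reps) = card reps"
    by (simp add: signature_reps card_cartesian_product card_cube_roots card_reps)
qed

lemma inj_reps:
  "inj_on Sigma_rep {1..3}"
  "inj_on (\<lambda>(i, j). D_rep i j) ({1..3} \<times> {1..2})"
  "inj_on (\<lambda>(i, k). T_rep i k) ({1..6} \<times> {0..2})"
proof -
  show "inj_on Sigma_rep {1..3}"
    using card_reps(1) by (intro eq_card_imp_inj_on) (simp_all add: Sigma_reps_def)
  show "inj_on (\<lambda>(i, j). D_rep i j) ({1..3} \<times> {1..2})"
    using card_reps(2) by (intro eq_card_imp_inj_on) (simp_all add: D_reps_def)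
  show "inj_on (\<lambda>(i, k). T_rep i k) ({1..6} \<times> {0..2})"
    using card_reps(3) by (intro eq_card_imp_inj_on) (simp_all add: T_reps_def)
qed

lemma ex1_rep_in_orbit:
  assumes "L \<in> P1"
  shows "\<exists>!R. R \<in> J_orbit L \<and> R \<in> reps"
proof -
  obtain R where R: "R \<in> reps" "signature R = signature L"
    using signature_mem_cube_roots[OF assms] signature_reps by (metis imageE)
  have *: "S \<in> J_orbit L \<longleftrightarrow> signature S = signature L" if "S \<in> reps" for S
    using that reps_subset_P1 assms mem_J_orbit_iff same_J_orbit_iff by blast
  show ?thesis
  proof (rule ex1I)
    show "R \<in> J_orbit L \<and> R \<in> reps" using R * by blast
    fix S assume S: "S \<in> J_orbit L \<and> S \<in> reps"
    then have "signature S = signature R" using *[of S] R(2) by simp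
    then show "S = R" using S R(1) inj_onD[OF inj_on_signature] by blast
  qed
qed

lemma J_orbits_eq: "J_orbit ` P1 = J_orbit ` reps"
proof -
  have "J_orbit L \<in> J_orbit ` reps" if L: "L \<in> P1" for L
  proof -
    obtain R where "R \<in> J_orbit L" "R \<in> reps" using ex1_rep_in_orbit[OF L] by blast
    then have "J_orbit R = J_orbit L" by (simp add: J_orbit_eq_iff mem_J_orbit_iff)
    then show ?thesis using \<open>R \<in> reps\<close> by (intro image_eqI[OF sym])
  qed
  then show ?thesis using reps_subset_P1 by blast
qed

lemma inj_on_J_orbit_reps: "inj_on J_orbit reps"
proof (rule inj_onI)
  fix R S assume RS: "R \<in> reps" "S \<in> reps" "J_orbit R = J_orbit S"
  then have "signature R = signature S"
    using same_J_orbit_iff[of R S] reps_subset_P1 by (auto simp: J_orbit_eq_iff)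
  then show "R = S" using RS inj_onD[OF inj_on_signature] by blast
qed

text \<open>Differences of \<open>\<lambda>\<close>-line elements in one orbit give \<open>J\<close>, and \<open>Sigma_rep\<close> gives the untwisted monomials.  The members of
\<open>T_rep 1\<close> for \<open>k = 0, 1\<close> then give two independent combinations of \<open>\<chi>\<^sub>1\<^sup>0\<close> and \<open>\<chi>\<^sub>2\<^sup>0\<close>, and those of \<open>T_rep 3\<close>
two of \<open>\<chi>\<^sub>1\<^sup>1\<close> and \<open>\<chi>\<^sub>2\<^sup>1\<close>.\<close>

lemma span_P1: "KI.span P1 = UNIV"
proof -
  have P1: "L \<in> KI.span P1" if "L \<in> reps" for L
    using that reps_subset_P1 KI.span_base by blast
  have Sigma: "Sigma_rep i \<in> reps" if "i \<in> {1..3}" for i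
    using that by (simp add: reps_def Sigma_reps_def)
  have chi0: "chi0 0 \<in> KI.span P1" "chi0 1 \<in> KI.span P1" "chi0 2 \<in> KI.span P1"
    using P1[OF Sigma[of 1]] P1[OF Sigma[of 2]] P1[OF Sigma[of 3]]
    by (simp_all add: Sigma_rep_def)
  have J: "v \<in> KI.span P1" if "v \<in> J" for v
  proof -
    have one: "chi0 0 \<in> P1"
      using reps_subset_P1 Sigma[of 1] by (auto simp: Sigma_rep_def)
    then have "v + chi0 0 \<in> P1" using that by (rule J_translate_mem_P1[rotated])
    then have "(v + chi0 0) - chi0 0 \<in> KI.span P1"
      using one by (intro KI.span_diff KI.span_base)
    then show ?thesis by simp
  qed
  have T: "T_rep i k \<in> KI.span P1" if "i \<in> {1..6}" "k \<in> {0..2}" for i k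
    using that by (intro P1) (force simp: reps_def T_reps_def)
  have separate: "x \<in> KI.span P1 \<and> y \<in> KI.span P1"
    if "x + y \<in> KI.span P1" "zeta3 *\<^sub>K x + zeta3\<^sup>2 *\<^sub>K y \<in> KI.span P1" for x y
  proof -
    have "zeta3\<^sup>2 - zeta3 \<noteq> 0" using zeta3_neq_1 by (simp add: power2_eq_square)
    moreover have "(zeta3\<^sup>2 - zeta3) *\<^sub>K y
        = (zeta3 *\<^sub>K x + zeta3\<^sup>2 *\<^sub>K y) - zeta3 *\<^sub>K (x + y)"
      by (simp add: KI.scale_left_diff_distrib KI.scale_right_distrib)
    then have "(zeta3\<^sup>2 - zeta3) *\<^sub>K y \<in> KI.span P1"
      using that by (simp only: KI.span_diff KI.span_scale)
    ultimately have y: "y \<in> KI.span P1"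
      using KI.span_scale[of "(zeta3\<^sup>2 - zeta3) *\<^sub>K y" P1 "1 / (zeta3\<^sup>2 - zeta3)"] by simp
    then show ?thesis using KI.span_diff[OF that(1) y] by simp
  qed
  have tripled: "3 *\<^sub>K ((1/3) *\<^sub>K x) = x" for x by simp
  have "chi1 0 \<in> KI.span P1 \<and> chi2 0 \<in> KI.span P1"
  proof (rule separate)
    have "zeta3 ^ k *\<^sub>K chi1 0 + zeta3 ^ (2 * k) *\<^sub>K chi2 0 \<in> KI.span P1" if "k \<in> {0..2}" for k
    proof -
      have "zeta3 ^ k *\<^sub>K chi1 0 + zeta3 ^ (2 * k) *\<^sub>K chi2 0
          = 3 *\<^sub>K T_rep 1 k - (chi0 0 + 2 *\<^sub>K chi0 2)"
        unfolding T_rep_simps tripled by simp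
      also have "\<dots> \<in> KI.span P1"
        using that by (intro KI.span_diff KI.span_add KI.span_scale chi0 T) simp_all
      finally show ?thesis .
    qed
    from this[of 0] this[of 1] show "chi1 0 + chi2 0 \<in> KI.span P1"
      "zeta3 *\<^sub>K chi1 0 + zeta3\<^sup>2 *\<^sub>K chi2 0 \<in> KI.span P1" by simp_all
  qed
  moreover have "chi1 1 \<in> KI.span P1 \<and> chi2 1 \<in> KI.span P1"
  proof (rule separate)
    have "zeta3 ^ k *\<^sub>K chi1 1 + zeta3 ^ (2 * k) *\<^sub>K chi2 1 \<in> KI.span P1" if "k \<in> {0..2}" for k
    proof -
      have "zeta3 ^ k *\<^sub>K chi1 1 + zeta3 ^ (2 * k) *\<^sub>K chi2 1
          = 3 *\<^sub>K T_rep 3 k - (2 *\<^sub>K chi0 0 + chi0 1)"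
        unfolding T_rep_simps tripled by simp
      also have "\<dots> \<in> KI.span P1"
        using that by (intro KI.span_diff KI.span_add KI.span_scale chi0 T) simp_all
      finally show ?thesis .
    qed
    from this[of 0] this[of 1] show "chi1 1 + chi2 1 \<in> KI.span P1"
      "zeta3 *\<^sub>K chi1 1 + zeta3\<^sup>2 *\<^sub>K chi2 1 \<in> KI.span P1" by simp_all
  qed
  moreover have "{Delta0, Delta1, Delta2} \<subseteq> J" by (simp add: mem_J_iff)
  ultimately have "KI_basis \<subseteq> KI.span P1"
    using chi0 J unfolding KI_basis_def by blast
  then have "KI.span KI_basis \<subseteq> KI.span P1"
    by (rule KI.span_minimal) (rule KI.subspace_span)
  then show ?thesis by (simp add: span_KI_basis top.extremum_unique)
qed

theorem proposition7p22:
  shows "KI.span P1 = UNIV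
    \<and> (\<forall>L\<in>P1. dagger L \<in> P1 \<and> L * dagger L = 1)
    \<and> (\<forall>v\<in>J. \<forall>L\<in>P1. v + L \<in> P1)
    \<and> card (J_orbit ` P1) = 27
    \<and> Sigma_reps \<union> D_reps \<union> T_reps \<subseteq> P1
    \<and> (\<forall>C \<in> J_orbit ` P1. \<exists>!R. R \<in> C \<and> R \<in> Sigma_reps \<union> D_reps \<union> T_reps)
    \<and> inj_on Sigma_rep {1..3}
    \<and> inj_on (\<lambda>(i, j). D_rep i j) ({1..3} \<times> {1..2})
    \<and> inj_on (\<lambda>(i, k). T_rep i k) ({1..6} \<times> {0..2})
    \<and> Sigma_reps \<inter> D_reps = {} \<and> Sigma_reps \<inter> T_reps = {} \<and> D_reps \<inter> T_reps = {}"
  unfolding reps_def[symmetric]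
proof (intro conjI ballI)
  show "card (J_orbit ` P1) = 27"
    unfolding J_orbits_eq card_image[OF inj_on_J_orbit_reps] by (rule card_reps)
  show "\<exists>!R. R \<in> C \<and> R \<in> reps" if "C \<in> J_orbit ` P1" for C
    using that ex1_rep_in_orbit by blast
  show "L * dagger L = 1" if "L \<in> P1" for L
    using P1_power[OF that] by (intro mult_dagger_eq_1 allI)
qed (fact span_P1 dagger_mem_P1 J_translate_mem_P1 reps_subset_P1 inj_reps card_reps)+

end
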